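(* The Ilias model structure $(\mathbf{Cat})_{DK}=(\mathcal{C}_{DK},\mathcal{F}_{DK},\mathcal{W}_{DK})$ on $\mathbf{Cat}$ cannot be left-lifted along the left adjoint $I^+:\mathbf{Flow}\to\mathbf{Cat}$; that is, there is no model structure on $\mathbf{Flow}$ whose class of cofibrations is $(I^+)^{-1}(\mathcal{C}_{DK})$ and whose class of weak equivalences is $(I^+)^{-1}(\mathcal{W}_{DK})$.
   Context: $\mathbf{Top}$ denotes a locally presentable convenient category of topological spaces (for example, the category of $\Delta$-generated spaces). A flow is a small semicategory (a category without required identity maps) enriched over $(\mathbf{Top},\times)$: a flow $X$ consists of a set (discrete space) of states $X^0$, a space of execution paths $\mathbb{P}_{\alpha,\beta}X$ for each $(\alpha,\beta)\in X^0\times X^0$ (with $\mathbb{P}X=\coprod_{\alpha,\beta}\mathbb{P}_{\alpha,\beta}X$), and continuous associative composition maps $*:\mathbb{P}_{\alpha,\beta}X\times\mathbb{P}_{\beta,\gamma}X\to\mathbb{P}_{\alpha,\gamma}X$. Maps of flows are the enriched semifunctors; the category of flows is $\mathbf{Flow}$. A set is viewed as a flow with empty space of execution paths. $\mathbf{Cat}$ is the category of small categories enriched over $\mathbf{Top}$; $X(A,B)$ is the space of morphisms from $A$ to $B$. The functor $I^+:\mathbf{Flow}\to\mathbf{Cat}$ is the left adjoint of the inclusion $\mathbf{Cat}\subset\mathbf{Flow}$; it adds identity maps as isolated points of the spaces of morphisms. For a space $Z$, $\mathrm{Glob}(Z)$ is the flow with states $\{0,1\}$, $\mathbb{P}_{0,1}\mathrm{Glob}(Z)=Z$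 and no other execution paths. Let $\mathbf{D}^n$ be the $n$-dimensional disk and $\mathbf{S}^{n-1}$ its boundary sphere, with $\mathbf{D}^0=\{0\}$ and $\mathbf{S}^{-1}=\varnothing$. Let $I^{gl}=\{c_n:\mathrm{Glob}(\mathbf{S}^{n-1})\subset\mathrm{Glob}(\mathbf{D}^n)\mid n\geq 0\}$ and $C:\varnothing\to\{0\}$. For a $\mathbf{Top}$-enriched small category $X$, $\vec{\pi}_1(X)$ is the small category with the same objects and with morphisms the path-connected components of the spaces of morphisms. The Ilias model structure is the (known, unique) combinatorial model structure on $\mathbf{Cat}$ for which $I^+(I^{gl}\cup\{C\})$ is a set of generating cofibrations and the weak equivalences are the DK-equivalences, i.e. the enriched functors $F:\mathcal{C}\to\mathcal{D}$ such that $\vec{\pi}_1(F)$ is an equivalence of categories and $\mathcal{C}(\alpha,\beta)\to\mathcal{D}(F(\alpha),F(\beta))$ is a weak homotopy equivalence for all objects $\alpha,\beta$ of $\mathcal{C}$. *)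

theory Defs
  imports "HOL-Analysis.Analysis"
begin

unbundle cardinal_syntax

section \<open>The universe of small sets\<close>

text \<open>
  All categories live over a type \<open>'u\<close> whose cardinality is strongly inaccessible. A set, of any
  type, is small if its cardinality is less than that of \<open>'u\<close>. Up to bijection the small sets are
  the members of a Grothendieck universe, and each of them has a copy inside \<open>'u\<close>.
\<close>

definition small :: "'u itself \<Rightarrow> 'a set \<Rightarrow> bool" where
  "small U A \<longleftrightarrow> |A| <o |UNIV :: 'u set|"

definition inaccessible :: "'u itself \<Rightarrow> bool" where
  "inaccessible U \<longleftrightarrow>
     natLeq <o |UNIV :: 'u set| \<and>
     regularCard |UNIV :: 'u set| \<and>
     (\<forall>A :: 'u set. small U A \<longrightarrow> small U (Pow A))"

definition small_regular_cardinal :: "'u rel \<Rightarrow> bool" where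
  "small_regular_cardinal r \<longleftrightarrow>
     Card_order r \<and> infinite (Field r) \<and> regularCard r \<and> r <o |UNIV :: 'u set|"


section \<open>Categories\<close>

record ('o, 'm) category =
  Obj :: "'o set"
  Arr :: "'m set"
  Dom :: "'m \<Rightarrow> 'o"
  Cod :: "'m \<Rightarrow> 'o"
  Ide :: "'o \<Rightarrow> 'm"
  Comp :: "'m \<Rightarrow> 'm \<Rightarrow> 'm"  \<comment> \<open>\<open>Comp C g f\<close> is \<open>g\<close> after \<open>f\<close>\<close>

definition Hom :: "('o, 'm) category \<Rightarrow> 'o \<Rightarrow> 'o \<Rightarrow> 'm set" where
  "Hom C a b = {f \<in> Arr C. Dom C f = a \<and> Cod C f = b}"

definition is_category :: "('o, 'm) category \<Rightarrow> bool" where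
  "is_category C \<longleftrightarrow>
     (\<forall>f \<in> Arr C. Dom C f \<in> Obj C \<and> Cod C f \<in> Obj C) \<and>
     (\<forall>a \<in> Obj C. Ide C a \<in> Hom C a a) \<and>
     (\<forall>f \<in> Arr C. \<forall>g \<in> Arr C. Cod C f = Dom C g \<longrightarrow> Comp C g f \<in> Hom C (Dom C f) (Cod C g)) \<and>
     (\<forall>f \<in> Arr C. Comp C f (Ide C (Dom C f)) = f \<and> Comp C (Ide C (Cod C f)) f = f) \<and>
     (\<forall>f \<in> Arr C. \<forall>g \<in> Arr C. \<forall>h \<in> Arr C. Cod C f = Dom C g \<and> Cod C g = Dom C h \<longrightarrow>
        Comp C h (Comp C g f) = Comp C (Comp C h g) f)"

definition is_functor ::
  "('a, 'b) category \<Rightarrow> ('c, 'd) category \<Rightarrow> ('a \<Rightarrow> 'c) \<Rightarrow> ('b \<Rightarrow> 'd) \<Rightarrow> bool" where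
  "is_functor C D Fo Fm \<longleftrightarrow>
     (\<forall>a \<in> Obj C. Fo a \<in> Obj D) \<and>
     (\<forall>f \<in> Arr C. Fm f \<in> Hom D (Fo (Dom C f)) (Fo (Cod C f))) \<and>
     (\<forall>a \<in> Obj C. Fm (Ide C a) = Ide D (Fo a)) \<and>
     (\<forall>f \<in> Arr C. \<forall>g \<in> Arr C. Cod C f = Dom C g \<longrightarrow> Fm (Comp C g f) = Comp D (Fm g) (Fm f))"

definition is_iso :: "('o, 'm) category \<Rightarrow> 'm \<Rightarrow> bool" where
  "is_iso C f \<longleftrightarrow> f \<in> Arr C \<and>
     (\<exists>g \<in> Hom C (Cod C f) (Dom C f).
        Comp C g f = Ide C (Dom C f) \<and> Comp C f g = Ide C (Cod C f))"

definition is_natural ::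
  "('a, 'b) category \<Rightarrow> ('c, 'd) category \<Rightarrow> ('a \<Rightarrow> 'c) \<Rightarrow> ('b \<Rightarrow> 'd) \<Rightarrow>
     ('a \<Rightarrow> 'c) \<Rightarrow> ('b \<Rightarrow> 'd) \<Rightarrow> ('a \<Rightarrow> 'd) \<Rightarrow> bool" where
  "is_natural C D Fo Fm Go Gm t \<longleftrightarrow>
     (\<forall>a \<in> Obj C. t a \<in> Hom D (Fo a) (Go a)) \<and>
     (\<forall>f \<in> Arr C. Comp D (t (Cod C f)) (Fm f) = Comp D (Gm f) (t (Dom C f)))"

definition is_equivalence ::
  "('a, 'b) category \<Rightarrow> ('c, 'd) category \<Rightarrow> ('a \<Rightarrow> 'c) \<Rightarrow> ('b \<Rightarrow> 'd) \<Rightarrow> bool" where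
  "is_equivalence C D Fo Fm \<longleftrightarrow>
     is_functor C D Fo Fm \<and>
     (\<exists>Go Gm s t.
        is_functor D C Go Gm \<and>
        is_natural C C id id (Go \<circ> Fo) (Gm \<circ> Fm) s \<and> (\<forall>a \<in> Obj C. is_iso C (s a)) \<and>
        is_natural D D (Fo \<circ> Go) (Fm \<circ> Gm) id id t \<and> (\<forall>b \<in> Obj D. is_iso D (t b)))"

definition is_left_adjoint ::
  "('a, 'b) category \<Rightarrow> ('c, 'd) category \<Rightarrow> ('a \<Rightarrow> 'c) \<Rightarrow> ('b \<Rightarrow> 'd) \<Rightarrow>
     ('c \<Rightarrow> 'a) \<Rightarrow> ('d \<Rightarrow> 'b) \<Rightarrow> bool" where
  "is_left_adjoint C D Lo Lm Ro Rm \<longleftrightarrow>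
     is_functor C D Lo Lm \<and> is_functor D C Ro Rm \<and>
     (\<exists>unit. is_natural C C id id (Ro \<circ> Lo) (Rm \<circ> Lm) unit \<and>
        (\<forall>a \<in> Obj C. \<forall>b \<in> Obj D. \<forall>f \<in> Hom C a (Ro b).
           \<exists>!g. g \<in> Hom D (Lo a) b \<and> Comp C (Rm g) (unit a) = f))"


subsection \<open>Limits and colimits\<close>

definition is_cone ::
  "('o, 'm) category \<Rightarrow> ('i, 'j) category \<Rightarrow> ('i \<Rightarrow> 'o) \<Rightarrow> ('j \<Rightarrow> 'm) \<Rightarrow> 'o \<Rightarrow> ('i \<Rightarrow> 'm) \<Rightarrow> bool" where
  "is_cone C J Fo Fm L p \<longleftrightarrow>
     L \<in> Obj C \<and> (\<forall>j \<in> Obj J. p j \<in> Hom C L (Fo j)) \<and>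
     (\<forall>f \<in> Arr J. Comp C (Fm f) (p (Dom J f)) = p (Cod J f))"

definition is_limit ::
  "('o, 'm) category \<Rightarrow> ('i, 'j) category \<Rightarrow> ('i \<Rightarrow> 'o) \<Rightarrow> ('j \<Rightarrow> 'm) \<Rightarrow> 'o \<Rightarrow> ('i \<Rightarrow> 'm) \<Rightarrow> bool" where
  "is_limit C J Fo Fm L p \<longleftrightarrow>
     is_cone C J Fo Fm L p \<and>
     (\<forall>L' p'. is_cone C J Fo Fm L' p' \<longrightarrow>
        (\<exists>!u. u \<in> Hom C L' L \<and> (\<forall>j \<in> Obj J. Comp C (p j) u = p' j)))"

definition is_cocone ::
  "('o, 'm) category \<Rightarrow> ('i, 'j) category \<Rightarrow> ('i \<Rightarrow> 'o) \<Rightarrow> ('j \<Rightarrow> 'm) \<Rightarrow> 'o \<Rightarrow> ('i \<Rightarrow> 'm) \<Rightarrow> bool" where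
  "is_cocone C J Fo Fm L c \<longleftrightarrow>
     L \<in> Obj C \<and> (\<forall>j \<in> Obj J. c j \<in> Hom C (Fo j) L) \<and>
     (\<forall>f \<in> Arr J. Comp C (c (Cod J f)) (Fm f) = c (Dom J f))"

definition is_colimit ::
  "('o, 'm) category \<Rightarrow> ('i, 'j) category \<Rightarrow> ('i \<Rightarrow> 'o) \<Rightarrow> ('j \<Rightarrow> 'm) \<Rightarrow> 'o \<Rightarrow> ('i \<Rightarrow> 'm) \<Rightarrow> bool" where
  "is_colimit C J Fo Fm L c \<longleftrightarrow>
     is_cocone C J Fo Fm L c \<and>
     (\<forall>L' c'. is_cocone C J Fo Fm L' c' \<longrightarrow>
        (\<exists>!u. u \<in> Hom C L L' \<and> (\<forall>j \<in> Obj J. Comp C u (c j) = c' j)))"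

text \<open>Every small category is isomorphic to one whose objects and arrows are elements of \<open>'u\<close>.\<close>

definition small_category :: "('u, 'u) category \<Rightarrow> bool" where
  "small_category J \<longleftrightarrow>
     is_category J \<and> small TYPE('u) (Obj J) \<and> small TYPE('u) (Arr J)"

definition has_small_limits :: "'u itself \<Rightarrow> ('o, 'm) category \<Rightarrow> bool" where
  "has_small_limits U C \<longleftrightarrow>
     (\<forall>(J :: ('u, 'u) category) Fo Fm. small_category J \<and> is_functor J C Fo Fm \<longrightarrow>
        (\<exists>L p. is_limit C J Fo Fm L p))"

definition has_small_colimits :: "'u itself \<Rightarrow> ('o, 'm) category \<Rightarrow> bool" where
  "has_small_colimits U C \<longleftrightarrow>
     (\<forall>(J :: ('u, 'u) category) Fo Fm. small_category J \<and> is_functor J C Fo Fm \<longrightarrow>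
        (\<exists>L c. is_colimit C J Fo Fm L c))"

definition is_terminal :: "('o, 'm) category \<Rightarrow> 'o \<Rightarrow> bool" where
  "is_terminal C t \<longleftrightarrow> t \<in> Obj C \<and> (\<forall>x \<in> Obj C. \<exists>!f. f \<in> Hom C x t)"

definition is_product :: "('o, 'm) category \<Rightarrow> 'o \<Rightarrow> 'o \<Rightarrow> 'o \<Rightarrow> 'm \<Rightarrow> 'm \<Rightarrow> bool" where
  "is_product C a b P p q \<longleftrightarrow>
     P \<in> Obj C \<and> p \<in> Hom C P a \<and> q \<in> Hom C P b \<and>
     (\<forall>x \<in> Obj C. \<forall>f \<in> Hom C x a. \<forall>g \<in> Hom C x b.
        \<exists>!u. u \<in> Hom C x P \<and> Comp C p u = f \<and> Comp C q u = g)"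

text \<open>
  \<open>E\<close> is the exponential of \<open>c\<close> by \<open>b\<close>, with evaluation \<open>ev\<close> defined on the product \<open>(P, p, q)\<close> of
  \<open>E\<close> and \<open>b\<close>; below, \<open>k\<close> is the arrow \<open>h \<times> id\<close>.
\<close>

definition is_exponential ::
  "('o, 'm) category \<Rightarrow> 'o \<Rightarrow> 'o \<Rightarrow> 'o \<Rightarrow> 'o \<Rightarrow> 'm \<Rightarrow> 'm \<Rightarrow> 'm \<Rightarrow> bool" where
  "is_exponential C b c E P p q ev \<longleftrightarrow>
     is_product C E b P p q \<and> ev \<in> Hom C P c \<and>
     (\<forall>x \<in> Obj C. \<forall>P' p' q'. is_product C x b P' p' q' \<longrightarrow> (\<forall>g \<in> Hom C P' c.
        \<exists>!h. h \<in> Hom C x E \<and>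
          (\<exists>k \<in> Hom C P' P. Comp C p k = Comp C h p' \<and> Comp C q k = q' \<and> Comp C ev k = g)))"

definition cartesian_closed :: "('o, 'm) category \<Rightarrow> bool" where
  "cartesian_closed C \<longleftrightarrow>
     (\<exists>t. is_terminal C t) \<and>
     (\<forall>a \<in> Obj C. \<forall>b \<in> Obj C. \<exists>P p q. is_product C a b P p q) \<and>
     (\<forall>b \<in> Obj C. \<forall>c \<in> Obj C. \<exists>E P p q ev. is_exponential C b c E P p q ev)"


subsection \<open>Locally presentable categories\<close>

text \<open>A small \<open>r\<close>-directed poset, regarded as a category.\<close>

definition small_directed_poset :: "'u rel \<Rightarrow> ('u, 'u) category \<Rightarrow> bool" where
  "small_directed_poset r J \<longleftrightarrow>
     small_category J \<and>
     (\<forall>i j. \<forall>f \<in> Hom J i j. \<forall>g \<in> Hom J i j. f = g) \<and>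
     (\<forall>i j. Hom J i j \<noteq> {} \<and> Hom J j i \<noteq> {} \<longrightarrow> i = j) \<and>
     (\<forall>S. S \<subseteq> Obj J \<and> |S| <o r \<longrightarrow> (\<exists>k \<in> Obj J. \<forall>j \<in> S. Hom J j k \<noteq> {}))"

text \<open>
  \<open>a\<close> is \<open>r\<close>-presentable: its representable functor preserves \<open>r\<close>-directed colimits. The two
  conjuncts say that the comparison map from the colimit of the hom-sets is onto and one-to-one.
\<close>

definition presentable :: "'u rel \<Rightarrow> ('o, 'm) category \<Rightarrow> 'o \<Rightarrow> bool" where
  "presentable r C a \<longleftrightarrow>
     a \<in> Obj C \<and>
     (\<forall>(J :: ('u, 'u) category) Fo Fm L c.
        small_directed_poset r J \<and> is_functor J C Fo Fm \<and> is_colimit C J Fo Fm L c \<longrightarrow>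
        (\<forall>f \<in> Hom C a L. \<exists>j \<in> Obj J. \<exists>g \<in> Hom C a (Fo j). Comp C (c j) g = f) \<and>
        (\<forall>j \<in> Obj J. \<forall>g \<in> Hom C a (Fo j). \<forall>g' \<in> Hom C a (Fo j).
           Comp C (c j) g = Comp C (c j) g' \<longrightarrow>
           (\<exists>k \<in> Obj J. \<exists>d \<in> Hom J j k. Comp C (Fm d) g = Comp C (Fm d) g')))"

definition locally_presentable :: "'u itself \<Rightarrow> ('o, 'm) category \<Rightarrow> bool" where
  "locally_presentable U C \<longleftrightarrow>
     has_small_colimits U C \<and>
     (\<exists>(r :: 'u rel) S.
        small_regular_cardinal r \<and> small U S \<and> (\<forall>a \<in> S. presentable r C a) \<and>
        (\<forall>x \<in> Obj C. \<exists>(J :: ('u, 'u) category) Fo Fm c.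
           small_directed_poset r J \<and> is_functor J C Fo Fm \<and> (\<forall>j \<in> Obj J. Fo j \<in> S) \<and>
           is_colimit C J Fo Fm x c))"


subsection \<open>Model structures\<close>

definition lifts :: "('o, 'm) category \<Rightarrow> 'm \<Rightarrow> 'm \<Rightarrow> bool" where
  "lifts C i p \<longleftrightarrow>
     (\<forall>u \<in> Hom C (Dom C i) (Dom C p). \<forall>v \<in> Hom C (Cod C i) (Cod C p).
        Comp C p u = Comp C v i \<longrightarrow>
        (\<exists>h \<in> Hom C (Cod C i) (Dom C p). Comp C h i = u \<and> Comp C p h = v))"

definition RLP :: "('o, 'm) category \<Rightarrow> 'm set \<Rightarrow> 'm set" where
  "RLP C S = {p \<in> Arr C. \<forall>i \<in> S. lifts C i p}"

definition LLP :: "('o, 'm) category \<Rightarrow> 'm set \<Rightarrow> 'm set" where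
  "LLP C S = {i \<in> Arr C. \<forall>p \<in> S. lifts C i p}"

definition is_retract :: "('o, 'm) category \<Rightarrow> 'm \<Rightarrow> 'm \<Rightarrow> bool" where
  "is_retract C f g \<longleftrightarrow>
     f \<in> Arr C \<and> g \<in> Arr C \<and>
     (\<exists>s \<in> Hom C (Dom C f) (Dom C g). \<exists>r \<in> Hom C (Dom C g) (Dom C f).
      \<exists>s' \<in> Hom C (Cod C f) (Cod C g). \<exists>r' \<in> Hom C (Cod C g) (Cod C f).
        Comp C r s = Ide C (Dom C f) \<and> Comp C r' s' = Ide C (Cod C f) \<and>
        Comp C g s = Comp C s' f \<and> Comp C f r = Comp C r' g)"

definition model_structure :: "('o, 'm) category \<Rightarrow> 'm set \<Rightarrow> 'm set \<Rightarrow> 'm set \<Rightarrow> bool" where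
  "model_structure M Cof Fib Weq \<longleftrightarrow>
     Cof \<subseteq> Arr M \<and> Fib \<subseteq> Arr M \<and> Weq \<subseteq> Arr M \<and>
     (\<forall>f \<in> Arr M. \<forall>g \<in> Arr M. Cod M f = Dom M g \<longrightarrow>
        (f \<in> Weq \<and> g \<in> Weq \<longrightarrow> Comp M g f \<in> Weq) \<and>
        (f \<in> Weq \<and> Comp M g f \<in> Weq \<longrightarrow> g \<in> Weq) \<and>
        (g \<in> Weq \<and> Comp M g f \<in> Weq \<longrightarrow> f \<in> Weq)) \<and>
     (\<forall>f g. is_retract M f g \<longrightarrow>
        (g \<in> Cof \<longrightarrow> f \<in> Cof) \<and> (g \<in> Fib \<longrightarrow> f \<in> Fib) \<and> (g \<in> Weq \<longrightarrow> f \<in> Weq)) \<and>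
     (\<forall>i \<in> Cof \<inter> Weq. \<forall>p \<in> Fib. lifts M i p) \<and>
     (\<forall>i \<in> Cof. \<forall>p \<in> Fib \<inter> Weq. lifts M i p) \<and>
     (\<forall>f \<in> Arr M.
        (\<exists>i \<in> Cof \<inter> Weq. \<exists>p \<in> Fib. Cod M i = Dom M p \<and> f = Comp M p i) \<and>
        (\<exists>i \<in> Cof. \<exists>p \<in> Fib \<inter> Weq. Cod M i = Dom M p \<and> f = Comp M p i))"

definition preimage_class :: "('o, 'm) category \<Rightarrow> ('m \<Rightarrow> 'n) \<Rightarrow> 'n set \<Rightarrow> 'm set" where
  "preimage_class M Fm S = {f \<in> Arr M. Fm f \<in> S}"


section \<open>Topological spaces\<close>

subsection \<open>Discs, CW-complexes and weak homotopy equivalences\<close>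

definition disc :: "nat \<Rightarrow> (nat \<Rightarrow> real) topology" where
  "disc n = subtopology (Euclidean_space n) {x. (\<Sum>i<n. (x i)\<^sup>2) \<le> 1}"

text \<open>The boundary sphere of dimension \<open>n - 1\<close>, which is empty for \<open>n = 0\<close>.\<close>

definition bsphere :: "nat \<Rightarrow> (nat \<Rightarrow> real) topology" where
  "bsphere n = subtopology (Euclidean_space n) {x. (\<Sum>i<n. (x i)\<^sup>2) = 1}"

definition open_cell :: "nat \<Rightarrow> (nat \<Rightarrow> real) set" where
  "open_cell n = topspace (disc n) - topspace (bsphere n)"

text \<open>
  \<open>X\<close> is a Hausdorff space with characteristic maps \<open>chi i\<close>, for \<open>i \<in> I\<close>, of the closed cells. Points
  of \<open>X\<close> suffice to index the cells, as distinct open cells are disjoint and nonempty.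
\<close>

definition CW_complex :: "'u topology \<Rightarrow> bool" where
  "CW_complex X \<longleftrightarrow>
     Hausdorff_space X \<and>
     (\<exists>(I :: 'u set) d chi.
        (\<forall>i \<in> I. continuous_map (disc (d i)) X (chi i) \<and>
           embedding_map (subtopology (disc (d i)) (open_cell (d i))) X (chi i)) \<and>
        topspace X = (\<Union>i \<in> I. chi i ` open_cell (d i)) \<and>
        (\<forall>i \<in> I. \<forall>j \<in> I. i \<noteq> j \<longrightarrow> chi i ` open_cell (d i) \<inter> chi j ` open_cell (d j) = {}) \<and>
        (\<forall>i \<in> I. \<exists>J. finite J \<and> J \<subseteq> {j \<in> I. d j < d i} \<and>
           chi i ` topspace (bsphere (d i)) \<subseteq> (\<Union>j \<in> J. chi j ` open_cell (d j))) \<and>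
        (\<forall>A \<subseteq> topspace X.
           (\<forall>i \<in> I. closedin (disc (d i)) {z \<in> topspace (disc (d i)). chi i z \<in> A}) \<longrightarrow>
           closedin X A))"

definition based_disc_maps :: "nat \<Rightarrow> 'a topology \<Rightarrow> 'a \<Rightarrow> ((nat \<Rightarrow> real) \<Rightarrow> 'a) set" where
  "based_disc_maps n X x =
     {s. continuous_map (disc n) X s \<and> s ` topspace (bsphere n) \<subseteq> {x}}"

definition based_homotopic ::
  "nat \<Rightarrow> 'a topology \<Rightarrow> 'a \<Rightarrow> ((nat \<Rightarrow> real) \<Rightarrow> 'a) \<Rightarrow> ((nat \<Rightarrow> real) \<Rightarrow> 'a) \<Rightarrow> bool" where
  "based_homotopic n X x = homotopic_with (\<lambda>s. s ` topspace (bsphere n) \<subseteq> {x}) (disc n) X"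

text \<open>
  The underlying set of the \<open>n\<close>-th homotopy group. The group structure is not needed: the map induced
  by a continuous map is a homomorphism, hence an isomorphism as soon as it is bijective.
\<close>

definition homotopy_group_set :: "nat \<Rightarrow> 'a topology \<Rightarrow> 'a \<Rightarrow> ((nat \<Rightarrow> real) \<Rightarrow> 'a) set set" where
  "homotopy_group_set n X x = {Collect (based_homotopic n X x s) | s. s \<in> based_disc_maps n X x}"

definition weak_homotopy_equivalence :: "'a topology \<Rightarrow> 'b topology \<Rightarrow> ('a \<Rightarrow> 'b) \<Rightarrow> bool" where
  "weak_homotopy_equivalence X Y f \<longleftrightarrow>
     continuous_map X Y f \<and>
     bij_betw (\<lambda>c. {y. \<exists>x \<in> c. path_component_of Y (f x) y})
       (path_components_of X) (path_components_of Y) \<and>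
     (\<forall>n \<ge> 1. \<forall>x \<in> topspace X.
        bij_betw (\<lambda>c. {t. \<exists>s \<in> c. based_homotopic n Y (f x) (f \<circ> s) t})
          (homotopy_group_set n X x) (homotopy_group_set n Y (f x)))"


subsection \<open>Convenient categories of topological spaces\<close>

text \<open>Arrows are triples (domain, function, codomain); functions are undefined outside the domain.\<close>

type_synonym 'u cmap = "'u topology \<times> ('u \<Rightarrow> 'u) \<times> 'u topology"

definition spaces :: "'u topology set \<Rightarrow> ('u topology, 'u cmap) category" where
  "spaces T = \<lparr>
     Obj = T,
     Arr = {(X, f, Y). X \<in> T \<and> Y \<in> T \<and> continuous_map X Y f \<and> f \<in> extensional (topspace X)},
     Dom = (\<lambda>(X, f, Y). X),
     Cod = (\<lambda>(X, f, Y). Y),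
     Ide = (\<lambda>X. (X, restrict id (topspace X), X)),
     Comp = (\<lambda>(Y, g, Z) (X, f, Y'). (X, compose (topspace X) g f, Z))\<rparr>"

definition cfun :: "'u cmap \<Rightarrow> 'u \<Rightarrow> 'u" where
  "cfun = (\<lambda>(X, f, Y). f)"

text \<open>
  A replete full subcategory of the category of small topological spaces which contains all
  (small) CW-complexes and is complete, cocomplete and cartesian closed.
\<close>

definition convenient :: "'u topology set \<Rightarrow> bool" where
  "convenient T \<longleftrightarrow>
     (\<forall>X \<in> T. small TYPE('u) (topspace X)) \<and>
     (\<forall>X \<in> T. \<forall>Y. X homeomorphic_space Y \<longrightarrow> Y \<in> T) \<and>
     (\<forall>X. small TYPE('u) (topspace X) \<and> CW_complex X \<longrightarrow> X \<in> T) \<and>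
     has_small_limits TYPE('u) (spaces T) \<and>
     has_small_colimits TYPE('u) (spaces T) \<and>
     cartesian_closed (spaces T)"


section \<open>Flows\<close>

record 'u flow =
  states :: "'u set"
  paths :: "'u \<Rightarrow> 'u \<Rightarrow> 'u topology"
  pcomp :: "'u \<Rightarrow> 'u \<Rightarrow> 'u \<Rightarrow> 'u \<Rightarrow> 'u \<Rightarrow> 'u"
    \<comment> \<open>\<open>pcomp X a b c x y\<close> is the composite \<open>x * y\<close> of \<open>x\<close> from \<open>a\<close> to \<open>b\<close> and \<open>y\<close> from \<open>b\<close> to \<open>c\<close>\<close>

abbreviation pspace :: "'u flow \<Rightarrow> 'u \<Rightarrow> 'u \<Rightarrow> 'u set" where
  "pspace X a b \<equiv> topspace (paths X a b)"

text \<open>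
  Composition has to be continuous on the binary product of \<^term>\<open>spaces T\<close>, whose topology may
  differ from the product topology.
\<close>

definition is_flow :: "'u topology set \<Rightarrow> 'u flow \<Rightarrow> bool" where
  "is_flow T X \<longleftrightarrow>
     small TYPE('u) (states X) \<and>
     (\<forall>a \<in> states X. \<forall>b \<in> states X. paths X a b \<in> T) \<and>
     (\<forall>a \<in> states X. \<forall>b \<in> states X. \<forall>c \<in> states X.
        (\<forall>x \<in> pspace X a b. \<forall>y \<in> pspace X b c. pcomp X a b c x y \<in> pspace X a c) \<and>
        (\<forall>P p q. is_product (spaces T) (paths X a b) (paths X b c) P p q \<longrightarrow>
           continuous_map P (paths X a c) (\<lambda>z. pcomp X a b c (cfun p z) (cfun q z)))) \<and>
     (\<forall>a \<in> states X. \<forall>b \<in> states X. \<forall>c \<in> states X. \<forall>d \<in> states X.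
        \<forall>x \<in> pspace X a b. \<forall>y \<in> pspace X b c. \<forall>z \<in> pspace X c d.
          pcomp X a c d (pcomp X a b c x y) z = pcomp X a b d x (pcomp X b c d y z))"

text \<open>
  Arrows are triples (domain, maps, codomain), where the maps consist of a map of states and, for
  each pair of states, a map of execution paths, all of them undefined outside their domains.
\<close>

type_synonym 'u flow_map = "'u flow \<times> (('u \<Rightarrow> 'u) \<times> ('u \<Rightarrow> 'u \<Rightarrow> 'u \<Rightarrow> 'u)) \<times> 'u flow"

definition fdom :: "'u flow_map \<Rightarrow> 'u flow" where
  "fdom = (\<lambda>(X, m, Y). X)"

definition fcod :: "'u flow_map \<Rightarrow> 'u flow" where
  "fcod = (\<lambda>(X, m, Y). Y)"

definition on_states :: "'u flow_map \<Rightarrow> 'u \<Rightarrow> 'u" where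
  "on_states = (\<lambda>(X, m, Y). fst m)"

definition on_paths :: "'u flow_map \<Rightarrow> 'u \<Rightarrow> 'u \<Rightarrow> 'u \<Rightarrow> 'u" where
  "on_paths = (\<lambda>(X, m, Y). snd m)"

definition mk_flow_map ::
  "'u flow \<Rightarrow> 'u flow \<Rightarrow> ('u \<Rightarrow> 'u) \<Rightarrow> ('u \<Rightarrow> 'u \<Rightarrow> 'u \<Rightarrow> 'u) \<Rightarrow> 'u flow_map" where
  "mk_flow_map X Y f0 f1 =
     (X,
      (\<lambda>a \<in> states X. f0 a,
       \<lambda>a b. if a \<in> states X \<and> b \<in> states X then \<lambda>x \<in> pspace X a b. f1 a b x else undefined),
      Y)"

definition flow_maps :: "'u topology set \<Rightarrow> 'u flow_map set" where
  "flow_maps T = {mk_flow_map X Y f0 f1 | X Y f0 f1.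
     is_flow T X \<and> is_flow T Y \<and>
     f0 ` states X \<subseteq> states Y \<and>
     (\<forall>a \<in> states X. \<forall>b \<in> states X.
        continuous_map (paths X a b) (paths Y (f0 a) (f0 b)) (f1 a b)) \<and>
     (\<forall>a \<in> states X. \<forall>b \<in> states X. \<forall>c \<in> states X. \<forall>x \<in> pspace X a b. \<forall>y \<in> pspace X b c.
        f1 a c (pcomp X a b c x y) = pcomp Y (f0 a) (f0 b) (f0 c) (f1 a b x) (f1 b c y))}"

definition flow_ide :: "'u flow \<Rightarrow> 'u flow_map" where
  "flow_ide X = mk_flow_map X X id (\<lambda>a b. id)"

definition flow_comp :: "'u flow_map \<Rightarrow> 'u flow_map \<Rightarrow> 'u flow_map" where
  "flow_comp g f = mk_flow_map (fdom f) (fcod g)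
     (on_states g \<circ> on_states f)
     (\<lambda>a b. on_paths g (on_states f a) (on_states f b) \<circ> on_paths f a b)"

definition Flow :: "'u topology set \<Rightarrow> ('u flow, 'u flow_map) category" where
  "Flow T = \<lparr>Obj = Collect (is_flow T), Arr = flow_maps T, Dom = fdom, Cod = fcod,
             Ide = flow_ide, Comp = flow_comp\<rparr>"


section \<open>Enriched small categories\<close>

text \<open>
  Identities are unique, so that the enriched small categories are the flows which have identities,
  and the enriched functors are the maps of flows which preserve them. The inclusion functor into
  \<^term>\<open>Flow T\<close> is thus the identity on objects and arrows.
\<close>

definition is_identity :: "'u flow \<Rightarrow> 'u \<Rightarrow> 'u \<Rightarrow> bool" where
  "is_identity X a e \<longleftrightarrow>
     e \<in> pspace X a a \<and>
     (\<forall>b \<in> states X. \<forall>x \<in> pspace X a b. pcomp X a a b e x = x) \<and>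
     (\<forall>b \<in> states X. \<forall>x \<in> pspace X b a. pcomp X b a a x e = x)"

definition identity :: "'u flow \<Rightarrow> 'u \<Rightarrow> 'u" where
  "identity X a = (THE e. is_identity X a e)"

definition is_enriched_category :: "'u topology set \<Rightarrow> 'u flow \<Rightarrow> bool" where
  "is_enriched_category T X \<longleftrightarrow> is_flow T X \<and> (\<forall>a \<in> states X. \<exists>e. is_identity X a e)"

definition enriched_functors :: "'u topology set \<Rightarrow> 'u flow_map set" where
  "enriched_functors T = {f \<in> flow_maps T.
     is_enriched_category T (fdom f) \<and> is_enriched_category T (fcod f) \<and>
     (\<forall>a \<in> states (fdom f).
        on_paths f a a (identity (fdom f) a) = identity (fcod f) (on_states f a))}"

definition TopCat :: "'u topology set \<Rightarrow> ('u flow, 'u flow_map) category" where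
  "TopCat T = \<lparr>Obj = Collect (is_enriched_category T), Arr = enriched_functors T,
               Dom = fdom, Cod = fcod, Ide = flow_ide, Comp = flow_comp\<rparr>"

text \<open>An arrow of the category of path components is a triple (source, path component, target).\<close>

definition pi1 :: "'u flow \<Rightarrow> ('u, 'u \<times> 'u set \<times> 'u) category" where
  "pi1 X = \<lparr>
     Obj = states X,
     Arr = {(a, c, b). a \<in> states X \<and> b \<in> states X \<and> c \<in> path_components_of (paths X a b)},
     Dom = (\<lambda>(a, c, b). a),
     Cod = (\<lambda>(a, c, b). b),
     Ide = (\<lambda>a. (a, path_component_of_set (paths X a a) (identity X a), a)),
     Comp = (\<lambda>(b, d, c) (a, c', b').
       (a, {z. \<exists>x \<in> c'. \<exists>y \<in> d. path_component_of (paths X a c) (pcomp X a b c x y) z}, c))\<rparr>"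

definition pi1_map :: "'u flow_map \<Rightarrow> 'u \<times> 'u set \<times> 'u \<Rightarrow> 'u \<times> 'u set \<times> 'u" where
  "pi1_map f = (\<lambda>(a, c, b).
     (on_states f a,
      {z. \<exists>x \<in> c. path_component_of
            (paths (fcod f) (on_states f a) (on_states f b)) (on_paths f a b x) z},
      on_states f b))"

definition DK_equivalences :: "'u topology set \<Rightarrow> 'u flow_map set" where
  "DK_equivalences T = {f \<in> enriched_functors T.
     is_equivalence (pi1 (fdom f)) (pi1 (fcod f)) (on_states f) (pi1_map f) \<and>
     (\<forall>a \<in> states (fdom f). \<forall>b \<in> states (fdom f).
        weak_homotopy_equivalence (paths (fdom f) a b)
          (paths (fcod f) (on_states f a) (on_states f b)) (on_paths f a b))}"


section \<open>Globes and the Ilias model structure\<close>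

text \<open>
  A fixed injection provides copies of the discs and spheres inside \<open>'u\<close>, as well as two elements
  \<open>0\<close> and \<open>1\<close>. It exists because the cardinality of \<open>'u\<close>, being inaccessible, exceeds the continuum.
\<close>

definition code :: "(nat \<Rightarrow> real) \<Rightarrow> 'u" where
  "code = (SOME f. inj f)"

definition zero_pt :: 'u where "zero_pt = code (\<lambda>i. 0)"

definition one_pt :: 'u where "one_pt = code (\<lambda>i. 1)"

definition coded :: "(nat \<Rightarrow> real) topology \<Rightarrow> 'u topology" where
  "coded X = pullback_topology (code ` topspace X) (inv code) X"

definition set_flow :: "'u set \<Rightarrow> 'u flow" where
  "set_flow S = \<lparr>states = S, paths = (\<lambda>a b. trivial_topology), pcomp = undefined\<rparr>"

definition Glob :: "'u topology \<Rightarrow> 'u flow" where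
  "Glob Z = \<lparr>
     states = {zero_pt, one_pt},
     paths = (\<lambda>a b. if a = zero_pt \<and> b = one_pt then Z else trivial_topology),
     pcomp = undefined\<rparr>"

definition flow_inclusion :: "'u flow \<Rightarrow> 'u flow \<Rightarrow> 'u flow_map" where
  "flow_inclusion X Y = mk_flow_map X Y id (\<lambda>a b. id)"

definition Igl :: "'u flow_map set" where
  "Igl = {flow_inclusion (Glob (coded (bsphere n))) (Glob (coded (disc n))) | n. True}"

definition Cmap :: "'u flow_map" where
  "Cmap = flow_inclusion (set_flow {}) (set_flow {zero_pt})"

text \<open>
  The two classes of maps which determine the Ilias model structure; \<open>Iarr\<close> is the action on arrows of
  the functor which freely adds identities. The cofibrations generated by a set \<open>S\<close> of maps are the
  maps with the left lifting property against all maps having the right lifting property against \<open>S\<close>.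
\<close>

definition Ilias_cofibrations :: "'u topology set \<Rightarrow> ('u flow_map \<Rightarrow> 'u flow_map) \<Rightarrow> 'u flow_map set" where
  "Ilias_cofibrations T Iarr = LLP (TopCat T) (RLP (TopCat T) (Iarr ` (Igl \<union> {Cmap})))"

definition Ilias_weak_equivalences :: "'u topology set \<Rightarrow> 'u flow_map set" where
  "Ilias_weak_equivalences T = DK_equivalences T"

end

theory Submission
  imports Defs
begin

text \<open>
  In a model structure, a map with the right lifting property against all cofibrations is a weak
  equivalence. Let \<open>p\<close> be the map of sets \<open>{0, 1} \<rightarrow> {0}\<close>, regarded as a map of flows. Applying the
  free category functor to \<open>p\<close> yields no DK-equivalence, because no path joins \<open>0\<close> to \<open>1\<close>, but \<open>0\<close>
  has an identity. Yet \<open>p\<close> has the right lifting property against every map of flows \<open>f : A \<rightarrow> B\<close>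
  that becomes a cofibration: given a lifting problem, \<open>A\<close> and \<open>B\<close> have no execution paths, so that
  only states matter, and there the problem is the transpose of one for the functor from the
  indiscrete category on \<open>{0, 1}\<close> to the one on \<open>{0}\<close>. That functor has the right lifting property
  against the generating cofibrations, as these are injective on states.
\<close>

section \<open>The coding of real sequences\<close>

text \<open>A real sequence can be coded by a subset of a countable set. The power set of a
  countable set is small because the cardinality of \<open>'u\<close> is an uncountable strong
  limit.\<close>

lemma small_real_sequences:
  assumes "inaccessible TYPE('u)"
  shows "|UNIV :: (nat \<Rightarrow> real) set| <o |UNIV :: 'u set|"
proof -
  have nat_less: "natLeq <o |UNIV :: 'u set|"
    and pow: "\<And>A :: 'u set. small TYPE('u) A \<Longrightarrow> small TYPE('u) (Pow A)"
    using assms by (auto simp: inaccessible_def)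
  have "|UNIV :: nat set| \<le>o |UNIV :: 'u set|"
    using card_of_nat nat_less ordIso_ordLeq_trans ordLess_imp_ordLeq by blast
  then obtain e :: "nat \<Rightarrow> 'u" where e: "inj e"
    using card_of_ordLeq[of "UNIV :: nat set" "UNIV :: 'u set"] by auto
  have "|range e| \<le>o |UNIV :: nat set|" by (rule card_of_image)
  then have "small TYPE('u) (range e)"
    unfolding small_def by (meson card_of_nat nat_less ordIso_ordLess_trans ordLeq_ordLess_trans)
  then have P: "|Pow (range e)| <o |UNIV :: 'u set|"
    using pow small_def by blast
  \<comment> \<open>\<open>cut f\<close> collects the lower Dedekind cuts of all entries of
    \<open>f\<close>, coded as points of \<open>range e\<close>. Density of the rationals recovers
    \<open>f\<close> from it.\<close>
  define cut :: "(nat \<Rightarrow> real) \<Rightarrow> 'u set"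
    where "cut f = e ` to_nat ` {(n, q :: rat). of_rat q < f n}" for f
  have "inj cut"
  proof (rule injI)
    fix f g assume "cut f = cut g"
    then have "{(n, q :: rat). of_rat q < f n} = {(n, q). of_rat q < g n}"
      unfolding cut_def using e by (simp add: inj_image_eq_iff)
    then have eq: "of_rat q < f n \<longleftrightarrow> of_rat q < g n" for n and q :: rat
      by (auto simp: set_eq_iff)
    show "f = g"
    proof
      fix n
      show "f n = g n"
        by (meson eq linorder_neqE_linordered_idom of_rat_dense order_less_asym)
    qed
  qed
  moreover have "range cut \<subseteq> Pow (range e)" by (auto simp: cut_def)
  ultimately have "|UNIV :: (nat \<Rightarrow> real) set| \<le>o |Pow (range e)|"
    using card_of_ordLeq[of "UNIV :: (nat \<Rightarrow> real) set" "Pow (range e)"] by auto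
  then show ?thesis using P ordLeq_ordLess_trans by blast
qed

text \<open>\<open>code\<close> is a Hilbert choice, so its injectivity rests on the existence of
  some injection, which the cardinal bound provides.\<close>

lemma inj_code:
  assumes "inaccessible TYPE('u)"
  shows "inj (code :: (nat \<Rightarrow> real) \<Rightarrow> 'u)"
proof -
  have "|UNIV :: (nat \<Rightarrow> real) set| \<le>o |UNIV :: 'u set|"
    using small_real_sequences[OF assms] ordLess_imp_ordLeq by blast
  then have "\<exists>f :: (nat \<Rightarrow> real) \<Rightarrow> 'u. inj f"
    using card_of_ordLeq[of "UNIV :: (nat \<Rightarrow> real) set" "UNIV :: 'u set"] by auto
  then show ?thesis unfolding code_def by (rule someI_ex)
qed

lemma infinite_inaccessible:
  assumes "inaccessible TYPE('u)"
  shows "infinite (UNIV :: 'u set)"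
  using assms unfolding inaccessible_def
  by (metis finite_iff_ordLess_natLeq ordLess_transitive ordLess_irreflexive)

lemma small_finite:
  assumes "inaccessible TYPE('u)" and "finite A"
  shows "small TYPE('u) A"
  using assms unfolding small_def
  by (meson finite_iff_ordLess_natLeq inaccessible_def ordLess_transitive)

text \<open>The pullback topology makes \<open>inv code\<close> continuous, and \<open>code\<close>
  is continuous into it because \<open>inv code\<close> undoes \<open>code\<close>.\<close>

lemma homeomorphic_maps_coded:
  assumes "inj (code :: (nat \<Rightarrow> real) \<Rightarrow> 'u)"
  shows "homeomorphic_maps X (coded X :: 'u topology) code (inv code)"
proof -
  have "continuous_map (coded X) X (id \<circ> (inv code :: 'u \<Rightarrow> _))"
    unfolding coded_def by (intro continuous_map_pullback continuous_map_id)
  moreover have "continuous_map X (coded X) (code :: _ \<Rightarrow> 'u)"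
    unfolding coded_def
    using assms by (intro continuous_map_pullback') (auto simp: o_def)
  ultimately show ?thesis
    using assms by (auto simp: homeomorphic_maps_def coded_def topspace_pullback_topology)
qed

section \<open>Cell structures on discs and spheres\<close>

text \<open>With finitely many compact cells the weak topology comes for free, and so does
  closure-finiteness. The cells are given in \<open>X\<close> and carried to \<open>Y\<close> by
  \<open>h\<close>, so that cell structures can be built on real sequences and then moved into
  \<open>'u\<close>.\<close>

lemma finite_CW_complexI:
  fixes X :: "'v topology" and Y :: "'u topology" and I :: "'i set"
  assumes inf: "infinite (UNIV :: 'u set)" and Haus: "Hausdorff_space X"
    and hom: "homeomorphic_map X Y h" and fin: "finite I"
    and compact: "\<And>i. i \<in> I \<Longrightarrow> compact_space (disc (d i))"
    and cont: "\<And>i. i \<in> I \<Longrightarrow> continuous_map (disc (d i)) X (chi i)"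
    and emb: "\<And>i. i \<in> I \<Longrightarrow>
      embedding_map (subtopology (disc (d i)) (open_cell (d i))) X (chi i)"
    and cover: "topspace X = (\<Union>i \<in> I. chi i ` open_cell (d i))"
    and disjoint: "\<And>i j. \<lbrakk>i \<in> I; j \<in> I; i \<noteq> j\<rbrakk> \<Longrightarrow>
      chi i ` open_cell (d i) \<inter> chi j ` open_cell (d j) = {}"
    and boundary: "\<And>i. i \<in> I \<Longrightarrow>
      chi i ` topspace (bsphere (d i)) \<subseteq> (\<Union>j \<in> {j \<in> I. d j < d i}. chi j ` open_cell (d j))"
  shows "CW_complex Y"
proof -
  \<comment> \<open>\<open>CW_complex\<close> indexes cells by elements of \<open>'u\<close>. The
    finite index set is moved there by \<open>e\<close> and decoded by \<open>k\<close>.\<close>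
  obtain e :: "'i \<Rightarrow> 'u" where e: "inj_on e I"
    using inf fin
    by (metis infinite_arbitrarily_large bij_betw_def
        finite_same_card_bij)
  define k where "k = inv_into I e"
  have k: "k (e i) = i" if "i \<in> I" for i using e that by (simp add: k_def)
  define chi' where "chi' u = h \<circ> chi (k u)" for u
  have chi': "chi' (e i) ` A = h ` chi i ` A" if "i \<in> I" for i A
    using k[OF that] by (simp add: chi'_def image_comp)
  have inj: "inj_on h (topspace X)" and cont_h: "continuous_map X Y h"
    and onto: "h ` topspace X = topspace Y" and emb_h: "embedding_map X Y h"
    using hom homeomorphic_imp_injective_map[OF hom] homeomorphic_imp_continuous_map[OF hom]
      homeomorphic_imp_surjective_map[OF hom] by (simp_all add: embedding_map_def)
  have HausY: "Hausdorff_space Y"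
    using Haus hom homeomorphic_map_imp_homeomorphic_space homeomorphic_Hausdorff_space by blast
  have cont': "continuous_map (disc (d i)) Y (h \<circ> chi i)" if "i \<in> I" for i
    using cont[OF that] cont_h continuous_map_compose by blast
  have cell_sub: "chi i ` open_cell (d i) \<subseteq> topspace X" if "i \<in> I" for i
    using cover that by blast
  show ?thesis
    unfolding CW_complex_def
  proof (rule conjI[OF HausY], rule exI[of _ "e ` I"], rule exI[of _ "d \<circ> k"],
      rule exI[of _ chi'], intro conjI ballI impI allI)
    fix u assume "u \<in> e ` I"
    then obtain i where i: "i \<in> I" "u = e i" by blast
    show "continuous_map (disc ((d \<circ> k) u)) Y (chi' u)"
      using i k cont' by (simp add: chi'_def)
    show "embedding_map (subtopology (disc ((d \<circ> k) u)) (open_cell ((d \<circ> k) u))) Y (chi' u)"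
      using i k embedding_map_compose[OF emb emb_h] by (simp add: chi'_def)
    show "\<exists>J. finite J \<and> J \<subseteq> {j \<in> e ` I. (d \<circ> k) j < (d \<circ> k) u} \<and>
      chi' u ` topspace (bsphere ((d \<circ> k) u)) \<subseteq> (\<Union>j\<in>J. chi' j ` open_cell ((d \<circ> k) j))"
    proof (intro exI[of _ "e ` {j \<in> I. d j < d i}"] conjI)
      have "chi' u ` topspace (bsphere ((d \<circ> k) u)) = h ` chi i ` topspace (bsphere (d i))"
        using i k chi' by simp
      also have "\<dots> \<subseteq> h ` (\<Union>j \<in> {j \<in> I. d j < d i}. chi j ` open_cell (d j))"
        using boundary i by blast
      also have "\<dots> = (\<Union>j\<in>e ` {j \<in> I. d j < d i}. chi' j ` open_cell ((d \<circ> k) j))"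
        by (auto simp: chi'_def k)
      finally show "chi' u ` topspace (bsphere ((d \<circ> k) u)) \<subseteq>
        (\<Union>j\<in>e ` {j \<in> I. d j < d i}. chi' j ` open_cell ((d \<circ> k) j))" .
    qed (use fin i k in auto)
  next
    have "topspace Y = h ` (\<Union>i \<in> I. chi i ` open_cell (d i))" using onto cover by simp
    also have "\<dots> = (\<Union>i\<in>e ` I. chi' i ` open_cell ((d \<circ> k) i))"
      by (auto simp: chi'_def k)
    finally show "topspace Y = (\<Union>i\<in>e ` I. chi' i ` open_cell ((d \<circ> k) i))" .
  next
    fix u v assume "u \<in> e ` I" "v \<in> e ` I" "u \<noteq> v"
    then obtain i j where ij: "i \<in> I" "u = e i" "j \<in> I" "v = e j" "i \<noteq> j" by blast
    have "h ` (chi i ` open_cell (d i)) \<inter> h ` (chi j ` open_cell (d j)) = {}"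
      using disjoint[OF ij(1,3,5)] inj_on_image_Int[OF inj cell_sub cell_sub] ij
      by (metis image_empty)
    then show "chi' u ` open_cell ((d \<circ> k) u) \<inter> chi' v ` open_cell ((d \<circ> k) v) = {}"
      using ij k chi' by simp
  next
    fix A
    assume A: "A \<subseteq> topspace Y"
      and cl: "\<forall>i\<in>e ` I. closedin (disc ((d \<circ> k) i)) {z \<in> topspace (disc ((d \<circ> k) i)). chi' i z \<in> A}"
    \<comment> \<open>\<open>B i\<close> is the preimage of \<open>A\<close> in the disc of cell
      \<open>i\<close>. It is closed in a compact space, so its image is compact and hence closed in
      the Hausdorff space \<open>Y\<close>; \<open>A\<close> is the finite union of these
      images.\<close>
    define B where "B i = {z \<in> topspace (disc (d i)). h (chi i z) \<in> A}" for i
    have "closedin (disc (d i)) (B i)" if "i \<in> I" for i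
      using cl that k by (auto simp: B_def chi'_def)
    then have "compactin (disc (d i)) (B i)" if "i \<in> I" for i
      using closedin_compact_space compact that by blast
    then have "closedin Y ((h \<circ> chi i) ` B i)" if "i \<in> I" for i
      using compactin_imp_closedin[OF HausY] image_compactin cont' that by blast
    then have "closedin Y (\<Union>i\<in>I. (h \<circ> chi i) ` B i)"
      using fin by (intro closedin_Union) auto
    moreover have "(\<Union>i\<in>I. (h \<circ> chi i) ` B i) = A"
    proof
      show "A \<subseteq> (\<Union>i\<in>I. (h \<circ> chi i) ` B i)"
      proof
        fix a assume "a \<in> A"
        then have "a \<in> h ` (\<Union>i \<in> I. chi i ` open_cell (d i))"
          using A onto cover by auto
        then obtain i z where "i \<in> I" "z \<in> open_cell (d i)" "a = h (chi i z)"
          by blast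
        then show "a \<in> (\<Union>i\<in>I. (h \<circ> chi i) ` B i)"
          using \<open>a \<in> A\<close> by (auto simp: B_def open_cell_def)
      qed
    qed (auto simp: B_def)
    ultimately show "closedin Y A" by simp
  qed
qed

section \<open>Discs, spheres and their hemispheres in the space of real sequences\<close>

text \<open>The euclidean topology on sequences is the product topology, so continuity on discs can
  be checked with \<open>continuous_on\<close>, coordinate by coordinate.\<close>

lemma disc_eq: "disc n = top_of_set {x. (\<forall>i\<ge>n. x i = 0) \<and> (\<Sum>i<n. (x i)\<^sup>2) \<le> 1}"
  by (simp add: disc_def Euclidean_space_def euclidean_product_topology subtopology_subtopology
      Int_def)

lemma bsphere_eq: "bsphere n = top_of_set {x. (\<forall>i\<ge>n. x i = 0) \<and> (\<Sum>i<n. (x i)\<^sup>2) = 1}"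
  by (simp add: bsphere_def Euclidean_space_def euclidean_product_topology subtopology_subtopology
      Int_def)

lemma open_cell_eq: "open_cell n = {x. (\<forall>i\<ge>n. x i = 0) \<and> (\<Sum>i<n. (x i)\<^sup>2) < 1}"
  by (auto simp: open_cell_def disc_eq bsphere_eq)

lemma continuous_on_coordinate: "continuous_on A (\<lambda>x :: nat \<Rightarrow> real. x i)"
  by (rule continuous_on_subset[OF continuous_on_product_coordinates subset_UNIV])

text \<open>The disc is a closed subset of an infinite product of intervals, which is compact by
  Tychonoff's theorem.\<close>

lemma compact_space_disc: "compact_space (disc n)"
proof -
  let ?D = "{x. (\<forall>i\<ge>n. x i = 0) \<and> (\<Sum>i<n. (x i)\<^sup>2) \<le> (1::real)}"
  have "compactin (powertop_real UNIV) (PiE UNIV (\<lambda>_. {-1..1}))"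
    by (simp add: compactin_PiE)
  then have box: "compact (PiE (UNIV :: nat set) (\<lambda>_. {-1..1::real}))"
    by (simp add: euclidean_product_topology)
  have closed: "closed ?D"
  proof -
    have "closed {x :: nat \<Rightarrow> real. x i = 0}" for i
      by (rule closed_Collect_eq[OF continuous_on_coordinate continuous_on_const])
    then have "closed {x :: nat \<Rightarrow> real. n \<le> i \<longrightarrow> x i = 0}" for i
      by (cases "n \<le> i") simp_all
    then have closed_zero: "closed (\<Inter>i. {x :: nat \<Rightarrow> real. n \<le> i \<longrightarrow> x i = 0})"
      by (intro closed_INT) blast
    have closed_ball: "closed {x :: nat \<Rightarrow> real. (\<Sum>i<n. (x i)\<^sup>2) \<le> 1}"
      by (rule closed_Collect_le[OF continuous_on_sum[OF continuous_on_power[OF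
              continuous_on_coordinate]] continuous_on_const])
    have D: "?D = (\<Inter>i. {x. n \<le> i \<longrightarrow> x i = 0}) \<inter> {x. (\<Sum>i<n. (x i)\<^sup>2) \<le> 1}"
      by blast
    show ?thesis unfolding D by (rule closed_Int[OF closed_zero closed_ball])
  qed
  have "?D \<subseteq> PiE UNIV (\<lambda>_. {-1..1})"
  proof
    fix x assume x: "x \<in> ?D"
    have "\<bar>x i\<bar> \<le> 1" for i
    proof (cases "i < n")
      case True
      then have "(x i)\<^sup>2 \<le> (\<Sum>i<n. (x i)\<^sup>2)"
        by (intro member_le_sum) auto
      then have "(x i)\<^sup>2 \<le> 1" using x by auto
      then show ?thesis by (simp add: abs_square_le_1)
    qed (use x in simp)
    then show "x \<in> PiE UNIV (\<lambda>_. {-1..1})" by (auto simp: abs_le_iff minus_le_iff)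
  qed
  then have "compact ?D"
    using compact_Int_closed[OF box closed] by (simp only: Int_absorb1)
  then show ?thesis by (simp add: disc_eq compact_space_subtopology)
qed

text \<open>
  The characteristic map of one of the two \<open>k\<close>-cells in the decomposition of spheres that has two
  cells, the open hemispheres, in each dimension.
\<close>

definition hemisphere :: "nat \<Rightarrow> bool \<Rightarrow> (nat \<Rightarrow> real) \<Rightarrow> nat \<Rightarrow> real" where
  "hemisphere k s x =
     (\<lambda>i. if i < k then x i
          else if i = k then (if s then 1 else -1) * sqrt (1 - (\<Sum>j<k. (x j)\<^sup>2)) else 0)"

text \<open>Forgetting coordinate \<open>k\<close> inverts the map: on the unit sphere the other
  coordinates determine its absolute value, and \<open>s\<close> fixes its sign.\<close>

lemma hemisphere_open_cell:
  "hemisphere k s ` open_cell k =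
     {y. (\<forall>i>k. y i = 0) \<and> (\<Sum>i\<le>k. (y i)\<^sup>2) = 1 \<and> (if s then y k > 0 else y k < 0)}"
    (is "_ = ?H")
proof
  show "hemisphere k s ` open_cell k \<subseteq> ?H"
    by (auto simp: hemisphere_def open_cell_eq lessThan_Suc_atMost[symmetric])
  show "?H \<subseteq> hemisphere k s ` open_cell k"
  proof
    fix y assume y: "y \<in> ?H"
    define x where "x i = (if i < k then y i else 0)" for i
    have sum: "(\<Sum>j<k. (x j)\<^sup>2) = 1 - (y k)\<^sup>2"
      using y by (auto simp: x_def lessThan_Suc_atMost[symmetric])
    have "(y k)\<^sup>2 > 0" using y by (auto split: if_splits)
    then have "x \<in> open_cell k" using sum by (auto simp: open_cell_eq x_def)
    moreover have "hemisphere k s x = y"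
      using y sum by (auto simp: hemisphere_def x_def fun_eq_iff split: if_splits)
    ultimately show "y \<in> hemisphere k s ` open_cell k" by blast
  qed
qed

lemma hemisphere_disc:
  assumes "x \<in> topspace (disc k)" "k < n"
  shows "hemisphere k s x \<in> topspace (bsphere n)"
proof -
  have "(\<Sum>i<n. (hemisphere k s x i)\<^sup>2) = (\<Sum>i<Suc k. (hemisphere k s x i)\<^sup>2)"
    using assms by (intro sum.mono_neutral_right) (auto simp: hemisphere_def)
  also have "\<dots> = 1" using assms by (simp add: hemisphere_def disc_eq)
  finally show ?thesis using assms by (auto simp: bsphere_eq hemisphere_def)
qed

text \<open>Every coordinate is continuous on the whole space, as \<open>sqrt\<close> is continuous
  on all reals, negative ones included.\<close>

lemma continuous_hemisphere: "continuous_on A (hemisphere k s)"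
proof (rule continuous_on_coordinatewise_then_product)
  fix i
  consider "i < k" | "i = k" | "i > k" by linarith
  then show "continuous_on A (\<lambda>x. hemisphere k s x i)"
    by cases (auto simp: hemisphere_def intro!: continuous_intros continuous_on_coordinate)
qed

lemma continuous_map_hemisphere:
  assumes "k < n"
  shows "continuous_map (disc k) (bsphere n) (hemisphere k s)"
  using hemisphere_disc[OF _ assms] continuous_hemisphere
  by (auto simp: disc_eq bsphere_eq)

lemma bsphere_subtopology: "bsphere n = subtopology (disc n) (topspace (bsphere n))"
proof -
  have "topspace (bsphere n) \<subseteq> topspace (disc n)" by (auto simp: disc_eq bsphere_eq)
  then show ?thesis by (simp add: bsphere_eq disc_eq subtopology_subtopology Int_absorb1)
qed

lemma continuous_map_bsphere_disc:
  "continuous_map X (bsphere n) f \<Longrightarrow> continuous_map X (disc n) f"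
  by (subst (asm) bsphere_subtopology) (rule continuous_map_into_fulltopology)

lemma embedding_map_bsphere_disc:
  "embedding_map X (bsphere n) f \<Longrightarrow> embedding_map X (disc n) f"
  by (subst (asm) bsphere_subtopology) (simp add: embedding_map_in_subtopology)

text \<open>Truncation to the first \<open>k\<close> coordinates is a continuous inverse on the
  image of the open cell.\<close>

lemma embedding_hemisphere:
  assumes "k < n"
  shows "embedding_map (subtopology (disc k) (open_cell k)) (bsphere n) (hemisphere k s)"
proof -
  have eq: "subtopology (disc k) (open_cell k) = top_of_set (open_cell k)"
  proof -
    have "open_cell k \<subseteq> topspace (disc k)" by (simp add: open_cell_def)
    then show ?thesis by (simp add: disc_eq subtopology_subtopology Int_absorb1)
  qed
  define g :: "(nat \<Rightarrow> real) \<Rightarrow> nat \<Rightarrow> real" where "g y i = (if i < k then y i else 0)" for y i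
  have gh: "g (hemisphere k s x) = x" if "x \<in> open_cell k" for x
    using that by (auto simp: g_def hemisphere_def open_cell_eq fun_eq_iff)
  have "continuous_on A g" for A
  proof (rule continuous_on_coordinatewise_then_product)
    show "continuous_on A (\<lambda>x. g x i)" for i
      by (cases "i < k") (auto simp: g_def continuous_on_coordinate)
  qed
  then have "homeomorphic_maps (top_of_set (open_cell k))
      (top_of_set (hemisphere k s ` open_cell k)) (hemisphere k s) g"
    using continuous_hemisphere gh by (force simp: homeomorphic_maps_def)
  moreover have "subtopology (bsphere n) (hemisphere k s ` open_cell k) =
      top_of_set (hemisphere k s ` open_cell k)"
  proof -
    have "hemisphere k s ` open_cell k \<subseteq> topspace (bsphere n)"
      using hemisphere_disc assms by (auto simp: open_cell_def)
    then show ?thesis by (simp add: bsphere_eq subtopology_subtopology Int_absorb1)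
  qed
  ultimately show ?thesis
    using homeomorphic_maps_map by (simp add: embedding_map_def eq) blast
qed

text \<open>The position and the sign of the last nonzero coordinate of a unit vector select its
  cell. For \<open>n = 0\<close> there are no cells and no points.\<close>

lemma topspace_bsphere_cells:
  "topspace (bsphere n) = (\<Union>j \<in> {..<n} \<times> UNIV. hemisphere (fst j) (snd j) ` open_cell (fst j))"
proof
  show "topspace (bsphere n) \<subseteq> (\<Union>j \<in> {..<n} \<times> UNIV. hemisphere (fst j) (snd j) ` open_cell (fst j))"
  proof
    fix y assume y: "y \<in> topspace (bsphere n)"
    have "\<exists>i. y i \<noteq> 0"
    proof (rule ccontr)
      assume "\<nexists>i. y i \<noteq> 0"
      then show False using y by (simp add: bsphere_eq)
    qed
    moreover have bound: "y i \<noteq> 0 \<Longrightarrow> i < n" for i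
      using y by (auto simp: bsphere_eq not_le[symmetric])
    ultimately obtain k where k: "y k \<noteq> 0" "\<And>i. y i \<noteq> 0 \<Longrightarrow> i \<le> k"
      using GreatestI_ex_nat[of "\<lambda>i. y i \<noteq> 0" n] Greatest_le_nat[of "\<lambda>i. y i \<noteq> 0" _ n]
      by (meson less_imp_le)
    have "(\<Sum>i<n. (y i)\<^sup>2) = (\<Sum>i\<le>k. (y i)\<^sup>2)"
    proof (rule sum.mono_neutral_right)
      show "{..k} \<subseteq> {..<n}" using bound[OF k(1)] by auto
      show "\<forall>i\<in>{..<n} - {..k}. (y i)\<^sup>2 = 0"
        using k(2) by (metis Diff_iff atMost_iff zero_power2)
    qed simp
    moreover have "\<forall>i>k. y i = 0" using k(2) by (meson not_le)
    ultimately have "y \<in> hemisphere k (y k > 0) ` open_cell k"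
      using y k(1) by (auto simp: hemisphere_open_cell bsphere_eq)
    then show "y \<in> (\<Union>j \<in> {..<n} \<times> UNIV. hemisphere (fst j) (snd j) ` open_cell (fst j))"
      using bound[OF k(1)] by (intro UN_I[of "(k, y k > 0)"]) auto
  qed
  show "(\<Union>j \<in> {..<n} \<times> UNIV. hemisphere (fst j) (snd j) ` open_cell (fst j)) \<subseteq> topspace (bsphere n)"
    using hemisphere_disc by (auto simp: open_cell_def)
qed

text \<open>A point determines its cell through the position and the sign of its last nonzero
  coordinate.\<close>

lemma hemisphere_disjoint:
  assumes "(k, s) \<noteq> (l, t)"
  shows "hemisphere k s ` open_cell k \<inter> hemisphere l t ` open_cell l = {}"
proof -
  have sign: "y k > 0 \<longleftrightarrow> s" "y k \<noteq> 0" and zero: "\<And>i. i > k \<Longrightarrow> y i = 0"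
    if "y \<in> hemisphere k s ` open_cell k" for y k s
    using that by (auto simp: hemisphere_open_cell split: if_splits)
  show ?thesis
  proof (rule ccontr)
    assume "\<not> ?thesis"
    then obtain y where y: "y \<in> hemisphere k s ` open_cell k" "y \<in> hemisphere l t ` open_cell l"
      by blast
    have "k = l"
      using sign(2)[OF y(1)] sign(2)[OF y(2)] zero[OF y(1)] zero[OF y(2)]
      by (metis linorder_neqE_nat)
    then show False using assms sign(1)[OF y(1)] sign(1)[OF y(2)] by simp
  qed
qed

text \<open>The square root vanishes on the boundary, so the attaching map is the inclusion of the
  equator.\<close>

lemma hemisphere_boundary:
  assumes "x \<in> topspace (bsphere k)"
  shows "hemisphere k s x = x"
  using assms by (auto simp: hemisphere_def bsphere_eq fun_eq_iff)

text \<open>There are two hemispheres in each dimension below \<open>n\<close>. The boundary of a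
  \<open>k\<close>-cell is attached along \<open>bsphere k\<close>, which is the union of all cells
  of lower dimension.\<close>

lemma CW_complex_bsphere:
  fixes Y :: "'u topology"
  assumes "infinite (UNIV :: 'u set)" and "homeomorphic_map (bsphere n) Y h"
  shows "CW_complex Y"
proof (rule finite_CW_complexI[where I = "{..<n} \<times> UNIV" and d = fst
      and chi = "\<lambda>j. hemisphere (fst j) (snd j)", OF assms(1) _ assms(2)])
  show "Hausdorff_space (bsphere n)"
    by (simp add: bsphere_eq Hausdorff_space_subtopology)
  fix i :: "nat \<times> bool" assume "i \<in> {..<n} \<times> UNIV"
  then obtain k s where i: "i = (k, s)" "k < n" by auto
  show "continuous_map (disc (fst i)) (bsphere n) (hemisphere (fst i) (snd i))"
    using i continuous_map_hemisphere by simp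
  show "embedding_map (subtopology (disc (fst i)) (open_cell (fst i))) (bsphere n)
      (hemisphere (fst i) (snd i))"
    using i embedding_hemisphere by simp
  have "{j \<in> {..<n} \<times> (UNIV :: bool set). fst j < fst i} = {..<k} \<times> UNIV"
    using i by auto
  then show "hemisphere (fst i) (snd i) ` topspace (bsphere (fst i)) \<subseteq>
      (\<Union>j\<in>{j \<in> {..<n} \<times> UNIV. fst j < fst i}. hemisphere (fst j) (snd j) ` open_cell (fst j))"
    using i by (simp add: hemisphere_boundary flip: topspace_bsphere_cells)
next
  fix i j :: "nat \<times> bool" assume "i \<noteq> j"
  then show "hemisphere (fst i) (snd i) ` open_cell (fst i) \<inter>
      hemisphere (fst j) (snd j) ` open_cell (fst j) = {}"
    by (intro hemisphere_disjoint) (simp add: prod_eq_iff)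
qed (auto simp: topspace_bsphere_cells compact_space_disc)

lemma topspace_disc_cells: "topspace (disc n) = topspace (bsphere n) \<union> open_cell n"
  by (auto simp: disc_eq bsphere_eq open_cell_eq)

lemma CW_complex_disc:
  fixes Y :: "'u topology"
  assumes "infinite (UNIV :: 'u set)" and "homeomorphic_map (disc n) Y h"
  shows "CW_complex Y"
proof -
  \<comment> \<open>The cells of the boundary sphere are supplemented by a single top cell, indexed
    by \<open>(n, True)\<close>, whose characteristic map is the identity.\<close>
  define I where "I = insert (n, True) ({..<n} \<times> UNIV)"
  define chi where "chi j = (if fst j = n then id else hemisphere (fst j) (snd j))" for j
  have low: "(\<Union>j\<in>{..<k} \<times> UNIV. chi j ` open_cell (fst j)) = topspace (bsphere k)"
    if "k \<le> n" for k
    unfolding topspace_bsphere_cells using that by (intro SUP_cong) (auto simp: chi_def)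
  show ?thesis
  proof (rule finite_CW_complexI[where I = I and d = fst and chi = chi, OF assms(1) _ assms(2)])
    show "Hausdorff_space (disc n)"
      by (simp add: disc_eq Hausdorff_space_subtopology)
    show "topspace (disc n) = (\<Union>i\<in>I. chi i ` open_cell (fst i))"
      unfolding I_def using low[of n] by (auto simp: topspace_disc_cells chi_def)
  next
    fix i assume "i \<in> I"
    then consider "i = (n, True)" | k s where "i = (k, s)" "k < n" by (auto simp: I_def)
    note i = this
    show "continuous_map (disc (fst i)) (disc n) (chi i)"
      using i
    proof cases
      case 2
      then show ?thesis
        using continuous_map_hemisphere[of k n s] continuous_map_bsphere_disc
        by (simp add: chi_def)
    qed (simp add: chi_def)
    show "embedding_map (subtopology (disc (fst i)) (open_cell (fst i))) (disc n) (chi i)"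
      using i
    proof cases
      case 2
      then show ?thesis
        using embedding_hemisphere[of k n s] embedding_map_bsphere_disc
        by (simp add: chi_def)
    qed (simp add: chi_def embedding_map_def homeomorphic_map_id subtopology_restrict flip: id_def)
    show "chi i ` topspace (bsphere (fst i)) \<subseteq>
        (\<Union>j\<in>{j \<in> I. fst j < fst i}. chi j ` open_cell (fst j))"
      using i
    proof cases
      case 1
      then have "{j \<in> I. fst j < fst i} = {..<n} \<times> UNIV" by (auto simp: I_def)
      then show ?thesis using low[of n] 1 by (simp add: chi_def)
    next
      case 2
      then have "{j \<in> I. fst j < fst i} = {..<k} \<times> UNIV" by (auto simp: I_def)
      then show ?thesis using 2 low[of k] by (auto simp: chi_def hemisphere_boundary)
    qed
  next
    have top: "chi (k, s) ` open_cell k \<inter> chi (n, True) ` open_cell n = {}" if "k < n" for k s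
    proof -
      have "chi (k, s) ` open_cell k \<subseteq> topspace (bsphere n)"
        using low[of n] that by fastforce
      then show ?thesis by (auto simp: chi_def open_cell_def)
    qed
    fix i j assume ij: "i \<in> I" "j \<in> I" "i \<noteq> j"
    then consider "i = (n, True)" "fst j < n" | "j = (n, True)" "fst i < n" | "fst i < n" "fst j < n"
      by (auto simp: I_def)
    then show "chi i ` open_cell (fst i) \<inter> chi j ` open_cell (fst j) = {}"
    proof cases
      case 3
      then show ?thesis
        using ij hemisphere_disjoint[of "fst i" "snd i" "fst j" "snd j"]
        by (simp add: chi_def prod_eq_iff)
    qed (use top[of "fst j" "snd j"] top[of "fst i" "snd i"] in auto)
  qed (auto simp: I_def compact_space_disc)
qed

section \<open>Coded discs and spheres as objects of a convenient category\<close>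

lemma topspace_coded:
  assumes "inaccessible TYPE('u)"
  shows "topspace (coded X :: 'u topology) = code ` topspace X"
  using homeomorphic_maps_coded[OF inj_code[OF assms], of X]
  by (metis homeomorphic_imp_surjective_map homeomorphic_maps_map)

lemma small_coded:
  assumes "inaccessible TYPE('u)"
  shows "small TYPE('u) (topspace (coded X :: 'u topology))"
proof -
  have "|code ` topspace X :: 'u set| \<le>o |topspace X|" by (rule card_of_image)
  also have "|topspace X| \<le>o |UNIV :: (nat \<Rightarrow> real) set|" by (rule card_of_mono1) simp
  finally show ?thesis
    unfolding small_def topspace_coded[OF assms]
    using small_real_sequences[OF assms] ordLeq_ordLess_trans by blast
qed

text \<open>A convenient category contains all small CW-complexes; the cell structures serve to
  place the discs and spheres among them.\<close>

lemma coded_in_convenient: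
  assumes inacc: "inaccessible TYPE('u)" and "convenient (T :: 'u topology set)"
  shows "coded (disc n) \<in> T" and "coded (bsphere n) \<in> T"
proof -
  have hom: "homeomorphic_map X (coded X :: 'u topology) code" for X
    using homeomorphic_maps_coded[OF inj_code[OF inacc], of X] homeomorphic_maps_map by blast
  have "\<forall>X. small TYPE('u) (topspace X) \<and> CW_complex X \<longrightarrow> X \<in> T"
    using assms(2) unfolding convenient_def by (elim conjE)
  then have CW: "X \<in> T" if "small TYPE('u) (topspace X)" "CW_complex X" for X
    using that by blast
  show "coded (disc n) \<in> T"
    by (rule CW[OF small_coded[OF inacc] CW_complex_disc[OF infinite_inaccessible[OF inacc] hom]])
  show "coded (bsphere n) \<in> T"
    by (rule CW[OF small_coded[OF inacc] CW_complex_bsphere[OF infinite_inaccessible[OF inacc] hom]])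
qed

text \<open>The only point of \<open>disc 0\<close> is the zero sequence, whose code is
  \<open>zero_pt\<close>. This is the one-point space that serves below as a space of execution
  paths.\<close>

lemma topspace_coded_disc_0:
  assumes "inaccessible TYPE('u)"
  shows "topspace (coded (disc 0) :: 'u topology) = {zero_pt}"
proof -
  have "topspace (disc 0) = {\<lambda>i. 0}" by (auto simp: disc_eq)
  then show ?thesis by (simp add: topspace_coded[OF assms] zero_pt_def)
qed

lemma coded_bsphere_0: "coded (bsphere 0) = trivial_topology"
  unfolding null_topspace_iff_trivial[symmetric]
  by (simp add: coded_def topspace_pullback_topology bsphere_eq)

lemma zero_neq_one:
  assumes "inaccessible TYPE('u)"
  shows "(zero_pt :: 'u) \<noteq> one_pt"
  using inj_code[OF assms] by (simp add: zero_pt_def one_pt_def inj_eq fun_eq_iff)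

lemma continuous_map_coded_inclusion:
  assumes "inaccessible TYPE('u)"
  shows "continuous_map (coded (bsphere n)) (coded (disc n) :: 'u topology) id"
proof -
  note coded = homeomorphic_maps_coded[OF inj_code[OF assms]]
  have "continuous_map (coded (bsphere n) :: 'u topology) (bsphere n) (inv code)"
    using coded by (simp add: homeomorphic_maps_def)
  then have "continuous_map (coded (bsphere n) :: 'u topology) (disc n) (inv code)"
    by (rule continuous_map_bsphere_disc)
  moreover have "continuous_map (disc n) (coded (disc n) :: 'u topology) code"
    using coded by (simp add: homeomorphic_maps_def)
  ultimately have "continuous_map (coded (bsphere n) :: 'u topology) (coded (disc n) :: 'u topology)
      (code \<circ> inv code)"
    by (rule continuous_map_compose)
  then show ?thesis
    by (rule continuous_map_eq) (auto simp: topspace_coded[OF assms] inj_code[OF assms])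
qed

section \<open>The category of flows\<close>

text \<open>The retract argument: factor \<open>p\<close> as a cofibration \<open>i\<close> followed
  by a trivial fibration \<open>r\<close>. Lifting \<open>p\<close> against \<open>i\<close>
  exhibits \<open>p\<close> as a retract of \<open>r\<close>.\<close>

lemma RLP_Cof_imp_Weq:
  assumes M: "is_category M" and model: "model_structure M Cof Fib Weq"
    and p: "p \<in> Arr M" and lift: "\<And>i. i \<in> Cof \<Longrightarrow> lifts M i p"
  shows "p \<in> Weq"
proof -
  have factor: "\<exists>i \<in> Cof. \<exists>r \<in> Fib \<inter> Weq. Cod M i = Dom M r \<and> p = Comp M r i"
    and sub: "Cof \<subseteq> Arr M" "Fib \<subseteq> Arr M"
    using model p unfolding model_structure_def by blast+
  obtain i r where i: "i \<in> Cof" "i \<in> Arr M" and r: "r \<in> Weq" "r \<in> Arr M"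
    and ir: "Cod M i = Dom M r" "p = Comp M r i"
    using factor sub by blast
  have ends: "Dom M p = Dom M i" "Cod M p = Cod M r"
    using M i r ir by (auto simp: is_category_def Hom_def)
  have objs: "Dom M p \<in> Obj M" "Cod M p \<in> Obj M"
    using M p by (auto simp: is_category_def)
  have ide: "Ide M a \<in> Hom M a a" if "a \<in> Obj M" for a
    using M that by (simp add: is_category_def)
  have unit: "Comp M f (Ide M (Dom M f)) = f" "Comp M (Ide M (Cod M f)) f = f" if "f \<in> Arr M" for f
    using M that by (auto simp: is_category_def)
  have "Ide M (Dom M p) \<in> Hom M (Dom M i) (Dom M p)" "r \<in> Hom M (Cod M i) (Cod M p)"
    "Comp M p (Ide M (Dom M p)) = Comp M r i"
    using ide[OF objs(1)] r ir ends unit[OF p] by (auto simp: Hom_def)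
  then obtain h where h: "h \<in> Hom M (Cod M i) (Dom M p)" "Comp M h i = Ide M (Dom M p)" "Comp M p h = r"
    using lift[OF i(1)] unfolding lifts_def by blast
  have "Comp M (Ide M (Cod M p)) (Ide M (Cod M p)) = Ide M (Cod M p)"
    using unit(1)[of "Ide M (Cod M p)"] ide[OF objs(2)] by (simp add: Hom_def)
  \<comment> \<open>On domains the retraction is \<open>i\<close> followed by \<open>h\<close>; on
    codomains it is the identity.\<close>
  then have "is_retract M p r"
    unfolding is_retract_def
    using p r i h ir ends ide[OF objs(2)] unit(2)[OF p] unit(2)[OF r(2)]
    by (intro conjI bexI[of _ i] bexI[of _ h] bexI[of _ "Ide M (Cod M p)"]) (auto simp: Hom_def)
  then show ?thesis using model r(1) by (auto simp: model_structure_def)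
qed

section \<open>Maps of flows and their composition\<close>

lemma mk_flow_map_sel [simp]:
  "fdom (mk_flow_map X Y f0 f1) = X"
  "fcod (mk_flow_map X Y f0 f1) = Y"
  "a \<in> states X \<Longrightarrow> on_states (mk_flow_map X Y f0 f1) a = f0 a"
  "\<lbrakk>a \<in> states X; b \<in> states X; x \<in> pspace X a b\<rbrakk> \<Longrightarrow>
     on_paths (mk_flow_map X Y f0 f1) a b x = f1 a b x"
  by (simp_all add: fdom_def fcod_def on_states_def on_paths_def mk_flow_map_def)

lemma mk_flow_map_in:
  assumes "is_flow T X" "is_flow T Y"
    and "\<And>a. a \<in> states X \<Longrightarrow> f0 a \<in> states Y"
    and "\<And>a b. \<lbrakk>a \<in> states X; b \<in> states X\<rbrakk> \<Longrightarrow>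
      continuous_map (paths X a b) (paths Y (f0 a) (f0 b)) (f1 a b)"
    and "\<And>a b c x y. \<lbrakk>a \<in> states X; b \<in> states X; c \<in> states X; x \<in> pspace X a b; y \<in> pspace X b c\<rbrakk> \<Longrightarrow>
      f1 a c (pcomp X a b c x y) = pcomp Y (f0 a) (f0 b) (f0 c) (f1 a b x) (f1 b c y)"
  shows "mk_flow_map X Y f0 f1 \<in> flow_maps T"
  unfolding flow_maps_def using assms by blast

lemma flow_pcomp_in:
  "\<lbrakk>is_flow T X; a \<in> states X; b \<in> states X; c \<in> states X; x \<in> pspace X a b; y \<in> pspace X b c\<rbrakk> \<Longrightarrow>
    pcomp X a b c x y \<in> pspace X a c"
  by (simp add: is_flow_def)

lemma flow_mapsD:
  assumes "f \<in> flow_maps T"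
  shows "is_flow T (fdom f)" and "is_flow T (fcod f)"
    and "a \<in> states (fdom f) \<Longrightarrow> on_states f a \<in> states (fcod f)"
    and "\<lbrakk>a \<in> states (fdom f); b \<in> states (fdom f)\<rbrakk> \<Longrightarrow>
      continuous_map (paths (fdom f) a b) (paths (fcod f) (on_states f a) (on_states f b))
        (on_paths f a b)"
    and "\<lbrakk>a \<in> states (fdom f); b \<in> states (fdom f); x \<in> pspace (fdom f) a b\<rbrakk> \<Longrightarrow>
      on_paths f a b x \<in> pspace (fcod f) (on_states f a) (on_states f b)"
    and "\<lbrakk>a \<in> states (fdom f); b \<in> states (fdom f); c \<in> states (fdom f);
        x \<in> pspace (fdom f) a b; y \<in> pspace (fdom f) b c\<rbrakk> \<Longrightarrow>
      on_paths f a c (pcomp (fdom f) a b c x y) =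
      pcomp (fcod f) (on_states f a) (on_states f b) (on_states f c)
        (on_paths f a b x) (on_paths f b c y)"
proof -
  obtain X Y f0 f1 where f: "f = mk_flow_map X Y f0 f1"
    and X: "is_flow T X" and Y: "is_flow T Y" and f0: "f0 ` states X \<subseteq> states Y"
    and cont: "\<forall>a \<in> states X. \<forall>b \<in> states X.
      continuous_map (paths X a b) (paths Y (f0 a) (f0 b)) (f1 a b)"
    and comp: "\<forall>a \<in> states X. \<forall>b \<in> states X. \<forall>c \<in> states X.
      \<forall>x \<in> pspace X a b. \<forall>y \<in> pspace X b c.
        f1 a c (pcomp X a b c x y) = pcomp Y (f0 a) (f0 b) (f0 c) (f1 a b x) (f1 b c y)"
    using assms unfolding flow_maps_def mem_Collect_eq by (elim exE conjE)
  show "is_flow T (fdom f)" "is_flow T (fcod f)" using X Y by (simp_all add: f)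
  show "a \<in> states (fdom f) \<Longrightarrow> on_states f a \<in> states (fcod f)" for a
    using f0 by (auto simp: f)
  show cont': "continuous_map (paths (fdom f) a b) (paths (fcod f) (on_states f a) (on_states f b))
        (on_paths f a b)" if "a \<in> states (fdom f)" "b \<in> states (fdom f)" for a b
    by (rule continuous_map_eq[of _ _ "f1 a b"]) (use that cont in \<open>simp_all add: f\<close>)
  show "on_paths f a b x \<in> pspace (fcod f) (on_states f a) (on_states f b)"
    if "a \<in> states (fdom f)" "b \<in> states (fdom f)" "x \<in> pspace (fdom f) a b" for a b x
    using continuous_map_image_subset_topspace[OF cont'[OF that(1,2)]] that(3) by blast
  show "on_paths f a c (pcomp (fdom f) a b c x y) =
      pcomp (fcod f) (on_states f a) (on_states f b) (on_states f c)
        (on_paths f a b x) (on_paths f b c y)"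
    if "a \<in> states (fdom f)" "b \<in> states (fdom f)" "c \<in> states (fdom f)"
      "x \<in> pspace (fdom f) a b" "y \<in> pspace (fdom f) b c" for a b c x y
    using that comp flow_pcomp_in[OF X] by (simp add: f)
qed

text \<open>The component maps are undefined outside their domains, so agreement on states and
  execution paths forces equality of the triples.\<close>

lemma flow_map_eqI:
  assumes f: "f \<in> flow_maps T" and g: "g \<in> flow_maps T"
    and eq: "fdom f = fdom g" "fcod f = fcod g"
    and states: "\<And>a. a \<in> states (fdom f) \<Longrightarrow> on_states f a = on_states g a"
    and paths: "\<And>a b x. \<lbrakk>a \<in> states (fdom f); b \<in> states (fdom f); x \<in> pspace (fdom f) a b\<rbrakk> \<Longrightarrow>
      on_paths f a b x = on_paths g a b x"
  shows "f = g"
proof -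
  obtain X Y f0 f1 where f': "f = mk_flow_map X Y f0 f1"
    using f by (auto simp: flow_maps_def)
  obtain X' Y' g0 g1 where g': "g = mk_flow_map X' Y' g0 g1"
    using g by (auto simp: flow_maps_def)
  have XY: "X' = X" "Y' = Y" using eq by (simp_all add: f' g')
  show ?thesis
    using states paths
    by (auto simp: f' g' XY mk_flow_map_def on_states_def on_paths_def fdom_def fun_eq_iff restrict_def)
qed

lemma flow_comp_sel [simp]:
  "fdom (flow_comp g f) = fdom f"
  "fcod (flow_comp g f) = fcod g"
  "a \<in> states (fdom f) \<Longrightarrow> on_states (flow_comp g f) a = on_states g (on_states f a)"
  "\<lbrakk>a \<in> states (fdom f); b \<in> states (fdom f); x \<in> pspace (fdom f) a b\<rbrakk> \<Longrightarrow>
     on_paths (flow_comp g f) a b x = on_paths g (on_states f a) (on_states f b) (on_paths f a b x)"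
  by (simp_all add: flow_comp_def)

lemma flow_comp_in:
  assumes f: "f \<in> flow_maps T" and g: "g \<in> flow_maps T" and fg: "fcod f = fdom g"
  shows "flow_comp g f \<in> flow_maps T"
  unfolding flow_comp_def
proof (rule mk_flow_map_in)
  show "continuous_map (paths (fdom f) a b)
      (paths (fcod g) ((on_states g \<circ> on_states f) a) ((on_states g \<circ> on_states f) b))
      (on_paths g (on_states f a) (on_states f b) \<circ> on_paths f a b)"
    if "a \<in> states (fdom f)" "b \<in> states (fdom f)" for a b
  proof -
    have "on_states f a \<in> states (fdom g)" "on_states f b \<in> states (fdom g)"
      using flow_mapsD(3)[OF f] that fg by auto
    then show ?thesis
      using continuous_map_compose[OF flow_mapsD(4)[OF f that, unfolded fg] flow_mapsD(4)[OF g]]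
      by simp
  qed
next
  fix a b c x y
  assume abc: "a \<in> states (fdom f)" "b \<in> states (fdom f)" "c \<in> states (fdom f)"
    "x \<in> pspace (fdom f) a b" "y \<in> pspace (fdom f) b c"
  have g_abc: "on_states f a \<in> states (fdom g)" "on_states f b \<in> states (fdom g)"
    "on_states f c \<in> states (fdom g)"
    "on_paths f a b x \<in> pspace (fdom g) (on_states f a) (on_states f b)"
    "on_paths f b c y \<in> pspace (fdom g) (on_states f b) (on_states f c)"
    using flow_mapsD(3,5)[OF f] abc by (simp_all flip: fg)
  show "(on_paths g (on_states f a) (on_states f c) \<circ> on_paths f a c) (pcomp (fdom f) a b c x y) =
      pcomp (fcod g) ((on_states g \<circ> on_states f) a) ((on_states g \<circ> on_states f) b)
        ((on_states g \<circ> on_states f) c)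
        ((on_paths g (on_states f a) (on_states f b) \<circ> on_paths f a b) x)
        ((on_paths g (on_states f b) (on_states f c) \<circ> on_paths f b c) y)"
    using flow_mapsD(6)[OF f abc] flow_mapsD(6)[OF g g_abc] by (simp add: fg)
qed (use flow_mapsD(1,3)[OF f] flow_mapsD(2,3)[OF g] fg in simp_all)

lemma flow_ide_in: "is_flow T X \<Longrightarrow> flow_ide X \<in> flow_maps T"
  unfolding flow_ide_def by (rule mk_flow_map_in) auto

lemma flow_ide_sel [simp]:
  "fdom (flow_ide X) = X"
  "fcod (flow_ide X) = X"
  "a \<in> states X \<Longrightarrow> on_states (flow_ide X) a = a"
  "\<lbrakk>a \<in> states X; b \<in> states X; x \<in> pspace X a b\<rbrakk> \<Longrightarrow> on_paths (flow_ide X) a b x = x"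
  by (simp_all add: flow_ide_def)

lemma Flow_sel [simp]:
  "Obj (Flow T) = Collect (is_flow T)" "Arr (Flow T) = flow_maps T"
  "Dom (Flow T) = fdom" "Cod (Flow T) = fcod" "Ide (Flow T) = flow_ide" "Comp (Flow T) = flow_comp"
  by (simp_all add: Flow_def)

lemma TopCat_sel [simp]:
  "Obj (TopCat T) = Collect (is_enriched_category T)" "Arr (TopCat T) = enriched_functors T"
  "Dom (TopCat T) = fdom" "Cod (TopCat T) = fcod" "Ide (TopCat T) = flow_ide"
  "Comp (TopCat T) = flow_comp"
  by (simp_all add: TopCat_def)

lemma is_category_Flow: "is_category (Flow T)"
  unfolding is_category_def
proof (intro conjI ballI impI)
  fix f assume f: "f \<in> Arr (Flow T)"
  then have f': "f \<in> flow_maps T" by simp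
  note D = flow_mapsD[OF f']
  show "Dom (Flow T) f \<in> Obj (Flow T)" "Cod (Flow T) f \<in> Obj (Flow T)"
    using D(1,2) by auto
  show "Comp (Flow T) f (Ide (Flow T) (Dom (Flow T) f)) = f"
    using f D
    by (auto intro!: flow_map_eqI[of _ T] flow_comp_in flow_ide_in)
  show "Comp (Flow T) (Ide (Flow T) (Cod (Flow T) f)) f = f"
    using f D
    by (auto intro!: flow_map_eqI[of _ T] flow_comp_in flow_ide_in)
  fix g assume g: "g \<in> Arr (Flow T)"
  show "Comp (Flow T) g f \<in> Hom (Flow T) (Dom (Flow T) f) (Cod (Flow T) g)"
    if "Cod (Flow T) f = Dom (Flow T) g"
    using f g that by (auto simp: Hom_def flow_comp_in)
  fix h assume h: "h \<in> Arr (Flow T)"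
  show "Comp (Flow T) h (Comp (Flow T) g f) = Comp (Flow T) (Comp (Flow T) h g) f"
    if "Cod (Flow T) f = Dom (Flow T) g \<and> Cod (Flow T) g = Dom (Flow T) h"
    using f g h that D
    by (auto intro!: flow_map_eqI[of _ T] flow_comp_in)
qed (auto simp: Hom_def flow_ide_in)

section \<open>Identities, and flows given by relations\<close>

lemma identity_unique:
  assumes "a \<in> states X" "is_identity X a e" "is_identity X a e'"
  shows "e = e'"
  using assms unfolding is_identity_def by metis

lemma is_identity_identity:
  assumes "is_enriched_category T X" "a \<in> states X"
  shows "is_identity X a (identity X a)"
proof -
  obtain e where "is_identity X a e"
    using assms by (auto simp: is_enriched_category_def)
  then show ?thesis
    unfolding identity_def using identity_unique[OF assms(2)] by (metis theI)
qed

text \<open>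
  The relations \<open>\<lambda>a b. False\<close>, \<open>(=)\<close> and \<open>\<lambda>a b. True\<close> give the flow without execution paths, the
  discrete category and the indiscrete category.
\<close>

definition relation_flow :: "('u \<Rightarrow> 'u \<Rightarrow> bool) \<Rightarrow> 'u set \<Rightarrow> 'u flow" where
  "relation_flow r S = \<lparr>
     states = S,
     paths = (\<lambda>a b. if r a b then coded (disc 0) else trivial_topology),
     pcomp = (\<lambda>a b c x y. zero_pt)\<rparr>"

text \<open>Nonempty path spaces of a relation flow consist of \<open>zero_pt\<close> alone, so a
  map into it is given by its action on states.\<close>

definition relation_map ::
  "('u \<Rightarrow> 'u \<Rightarrow> bool) \<Rightarrow> 'u set \<Rightarrow> 'u flow \<Rightarrow> ('u \<Rightarrow> 'u) \<Rightarrow> 'u flow_map" where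
  "relation_map r S X f0 = mk_flow_map X (relation_flow r S) f0 (\<lambda>a b x. zero_pt)"

lemma relation_map_sel [simp]:
  "fdom (relation_map r S X f0) = X"
  "fcod (relation_map r S X f0) = relation_flow r S"
  "a \<in> states X \<Longrightarrow> on_states (relation_map r S X f0) a = f0 a"
  by (simp_all add: relation_map_def)

lemma states_relation_flow [simp]: "states (relation_flow r S) = S"
  by (simp add: relation_flow_def)

lemma pcomp_relation_flow [simp]: "pcomp (relation_flow r S) a b c x y = zero_pt"
  by (simp add: relation_flow_def)

lemma continuous_map_from_empty: "topspace X = {} \<Longrightarrow> continuous_map X Y f"
  by (simp add: continuous_map_def)

locale convenient_spaces =
  fixes T :: "'u topology set"
  assumes inaccessible: "inaccessible TYPE('u)"
    and convenient: "convenient T"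
begin

lemma pspace_relation_flow [simp]:
  "pspace (relation_flow r S :: 'u flow) a b = (if r a b then {zero_pt} else {})"
  by (simp add: relation_flow_def topspace_coded_disc_0[OF inaccessible])

text \<open>The empty space enters \<open>T\<close> as the boundary of \<open>disc 0\<close>, a
  CW-complex without cells.\<close>

lemma trivial_topology_in: "trivial_topology \<in> T"
  using coded_in_convenient(2)[OF inaccessible convenient, of 0] by (simp add: coded_bsphere_0)

text \<open>The projections are functions on \<open>P\<close>, and a function into an empty set has
  empty domain. Continuity of composition thus becomes vacuous when there is nothing to
  compose.\<close>

lemma product_empty:
  assumes "is_product (spaces T) A B P p q" and "topspace A = {} \<or> topspace B = {}"
  shows "topspace P = {}"
proof -
  have "p \<in> Hom (spaces T) P A" "q \<in> Hom (spaces T) P B"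
    using assms(1) by (auto simp: is_product_def)
  then have "continuous_map P A (cfun p)" "continuous_map P B (cfun q)"
    by (auto simp: Hom_def spaces_def cfun_def)
  then show ?thesis
    using assms(2) continuous_map_image_subset_topspace by (metis image_is_empty subset_empty)
qed

text \<open>Composition is constant. Transitivity places its value in the right path space; where no
  paths compose, the product is empty.\<close>

lemma is_flow_relation_flow:
  assumes "finite S" and "transp_on S r"
  shows "is_flow T (relation_flow r S)"
  unfolding is_flow_def
proof (intro conjI ballI allI impI)
  show "small TYPE('u) (states (relation_flow r S))"
    using small_finite[OF inaccessible] assms(1) by simp
  fix a b
  assume a: "a \<in> states (relation_flow r S)" and b: "b \<in> states (relation_flow r S)"
  show "paths (relation_flow r S) a b \<in> T"
    using coded_in_convenient[OF inaccessible convenient] trivial_topology_in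
    by (simp add: relation_flow_def)
  fix c assume c: "c \<in> states (relation_flow r S)"
  have trans: "r a c" if "r a b" "r b c"
    using assms(2) that a b c by (auto dest: transp_onD)
  show "pcomp (relation_flow r S) a b c x y \<in> pspace (relation_flow r S) a c"
    if "x \<in> pspace (relation_flow r S) a b" "y \<in> pspace (relation_flow r S) b c" for x y
    using trans that by (auto split: if_splits)
  show "continuous_map P (paths (relation_flow r S) a c)
      (\<lambda>z. pcomp (relation_flow r S) a b c (cfun p z) (cfun q z))"
    if "is_product (spaces T) (paths (relation_flow r S) a b) (paths (relation_flow r S) b c) P p q"
    for P p q
  proof (cases "r a b \<and> r b c")
    case True
    then show ?thesis
      using trans topspace_coded_disc_0[OF inaccessible] by (simp add: relation_flow_def)
  next
    case False
    then have "topspace P = {}"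
      by (intro product_empty[OF that]) simp
    then show ?thesis by (rule continuous_map_from_empty)
  qed
qed (simp add: relation_flow_def)

lemma is_identity_relation_flow:
  fixes a :: 'u
  assumes "r a a"
  shows "is_identity (relation_flow r S) a zero_pt"
  using assms by (auto simp: is_identity_def split: if_splits)

lemma is_enriched_category_relation_flow:
  assumes "finite S" and "transp_on S r" and "reflp r"
  shows "is_enriched_category T (relation_flow r S)"
  using assms is_flow_relation_flow is_identity_relation_flow
  unfolding is_enriched_category_def by (meson reflpD)

lemma relation_map_in:
  assumes "is_flow T X" and "is_flow T (relation_flow r S)"
    and "\<And>a. a \<in> states X \<Longrightarrow> f0 a \<in> S"
    and rel: "\<And>a b. \<lbrakk>a \<in> states X; b \<in> states X; pspace X a b \<noteq> {}\<rbrakk> \<Longrightarrow> r (f0 a) (f0 b)"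
  shows "relation_map r S X f0 \<in> flow_maps T"
  unfolding relation_map_def
proof (rule mk_flow_map_in)
  fix a b assume ab: "a \<in> states X" "b \<in> states X"
  show "continuous_map (paths X a b) (paths (relation_flow r S) (f0 a) (f0 b)) (\<lambda>x. zero_pt)"
  proof (cases "pspace X a b = {}")
    case False
    then show ?thesis using rel[OF ab] by simp
  qed (rule continuous_map_from_empty)
qed (use assms in \<open>auto simp: relation_flow_def\<close>)

lemma relation_map_eqI:
  assumes f: "f \<in> flow_maps T" and g: "g \<in> flow_maps T"
    and eq: "fdom f = fdom g" and cod: "fcod f = relation_flow r S" "fcod g = relation_flow r S"
    and states: "\<And>a. a \<in> states (fdom f) \<Longrightarrow> on_states f a = on_states g a"
  shows "f = g"
proof (rule flow_map_eqI[OF f g eq])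
  fix a b x assume abx: "a \<in> states (fdom f)" "b \<in> states (fdom f)" "x \<in> pspace (fdom f) a b"
  then have "on_paths g a b x \<in> pspace (fcod g) (on_states g a) (on_states g b)"
    using flow_mapsD(5)[OF g] eq by simp
  then show "on_paths f a b x = on_paths g a b x"
    using flow_mapsD(5)[OF f abx] by (auto simp: cod split: if_splits)
qed (use cod states in auto)

text \<open>By reflexivity the only path from a state to itself is its identity, so identities are
  preserved automatically.\<close>

lemma enriched_functor_relation_flow:
  assumes f: "f \<in> flow_maps T" and cod: "fcod f = relation_flow r S" "reflp r"
    and cats: "is_enriched_category T (fdom f)" "is_enriched_category T (relation_flow r S)"
  shows "f \<in> enriched_functors T"
proof -
  have pt: "x = zero_pt" if "x \<in> pspace (relation_flow r S :: 'u flow) a b" for x a b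
    using that by (simp split: if_splits)
  have "on_paths f a a (identity (fdom f) a) = identity (fcod f) (on_states f a)"
    if a: "a \<in> states (fdom f)" for a
  proof -
    have "identity (fdom f) a \<in> pspace (fdom f) a a"
      using is_identity_identity[OF cats(1) a] by (simp add: is_identity_def)
    then have "on_paths f a a (identity (fdom f) a) = zero_pt"
      using flow_mapsD(5)[OF f a a] pt cod(1) by metis
    moreover have "identity (relation_flow r S) (on_states f a) = zero_pt"
      using is_identity_identity[OF cats(2), of "on_states f a"] flow_mapsD(3)[OF f a] pt cod(1)
      by (metis is_identity_def)
    ultimately show ?thesis using cod(1) by simp
  qed
  then show ?thesis using f cod cats by (simp add: enriched_functors_def)
qed

text \<open>All laws on composition hold vacuously. This covers \<open>set_flow\<close> and
  \<open>Glob\<close>, whose composition is \<open>undefined\<close>.\<close>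

lemma is_flow_no_composites:
  assumes "finite (states X)"
    and "\<And>a b. \<lbrakk>a \<in> states X; b \<in> states X\<rbrakk> \<Longrightarrow> paths X a b \<in> T"
    and no_comp: "\<And>a b c. \<lbrakk>a \<in> states X; b \<in> states X; c \<in> states X\<rbrakk> \<Longrightarrow>
      pspace X a b = {} \<or> pspace X b c = {}"
  shows "is_flow T X"
  unfolding is_flow_def
proof (intro conjI ballI allI impI)
  show "small TYPE('u) (states X)" using small_finite[OF inaccessible assms(1)] .
  fix a b c assume abc: "a \<in> states X" "b \<in> states X" "c \<in> states X"
  show "continuous_map P (paths X a c) (\<lambda>z. pcomp X a b c (cfun p z) (cfun q z))"
    if "is_product (spaces T) (paths X a b) (paths X b c) P p q" for P p q
    using product_empty[OF that no_comp[OF abc]] by (rule continuous_map_from_empty)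
qed (use assms(2) no_comp in blast)+

lemma is_flow_set_flow: "finite S \<Longrightarrow> is_flow T (set_flow S)"
  using trivial_topology_in by (intro is_flow_no_composites) (auto simp: set_flow_def)

lemma is_flow_Glob: "Z \<in> T \<Longrightarrow> is_flow T (Glob Z)"
  using trivial_topology_in zero_neq_one[OF inaccessible]
  by (intro is_flow_no_composites) (auto simp: Glob_def)

section \<open>The generating cofibrations\<close>

lemma generators_in: "Igl \<union> {Cmap} \<subseteq> flow_maps T"
proof -
  have "flow_inclusion (Glob (coded (bsphere n))) (Glob (coded (disc n))) \<in> flow_maps T" for n
    unfolding flow_inclusion_def
    using is_flow_Glob coded_in_convenient[OF inaccessible convenient]
      continuous_map_coded_inclusion[OF inaccessible] zero_neq_one[OF inaccessible]
    by (intro mk_flow_map_in) (auto simp: Glob_def split: if_splits)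
  moreover have "Cmap \<in> flow_maps T"
    unfolding Cmap_def flow_inclusion_def
    using is_flow_set_flow by (intro mk_flow_map_in) (auto simp: set_flow_def)
  ultimately show ?thesis by (auto simp: Igl_def)
qed

text \<open>All generators act on states by an inclusion. Injectivity is what will allow maps of
  states to be extended along them.\<close>

lemma generators_inj: "i \<in> Igl \<union> {Cmap} \<Longrightarrow> inj_on (on_states i) (states (fdom i))"
  by (auto simp: Igl_def Cmap_def flow_inclusion_def inj_on_def)

section \<open>The collapse maps from two states to one\<close>

abbreviation "two_states \<equiv> {zero_pt, one_pt :: 'u}"
abbreviation "one_state \<equiv> {zero_pt :: 'u}"
abbreviation "never \<equiv> \<lambda>(a :: 'u) (b :: 'u). False"
abbreviation "always \<equiv> \<lambda>(a :: 'u) (b :: 'u). True"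

text \<open>For \<open>never\<close> this is the map of sets that will contradict the model
  structure; for \<open>always\<close> it is the corresponding functor of indiscrete
  categories.\<close>

definition collapse :: "('u \<Rightarrow> 'u \<Rightarrow> bool) \<Rightarrow> 'u flow_map" where
  "collapse r = relation_map r one_state (relation_flow r two_states) (\<lambda>a. zero_pt)"

lemma flows_never: "is_flow T (relation_flow never two_states)" "is_flow T (relation_flow never one_state)"
  by (auto intro!: is_flow_relation_flow simp: transp_on_def)

lemma categories_always:
  "is_enriched_category T (relation_flow always two_states)"
  "is_enriched_category T (relation_flow always one_state)"
  by (auto intro!: is_enriched_category_relation_flow simp: transp_on_def reflp_def)

lemma flows_always: "is_flow T (relation_flow always two_states)" "is_flow T (relation_flow always one_state)"
  using categories_always by (auto simp: is_enriched_category_def)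

lemma collapse_in: "collapse never \<in> flow_maps T" "collapse always \<in> flow_maps T"
  unfolding collapse_def using flows_never flows_always by (auto intro!: relation_map_in)

lemma collapse_sel [simp]:
  "fdom (collapse r) = relation_flow r two_states" "fcod (collapse r) = relation_flow r one_state"
  "a \<in> two_states \<Longrightarrow> on_states (collapse r) a = zero_pt"
  by (auto simp: collapse_def)

text \<open>The target has one state and at most one path, so triangles and squares ending there
  commute automatically.\<close>

lemma map_to_one_eqI:
  assumes "f \<in> flow_maps T" "g \<in> flow_maps T" "fdom f = fdom g"
    and "fcod f = relation_flow r one_state" "fcod g = relation_flow r one_state"
  shows "f = g"
proof (rule relation_map_eqI[OF assms])
  show "on_states f a = on_states g a" if "a \<in> states (fdom f)" for a
    using flow_mapsD(3)[OF assms(1), of a] flow_mapsD(3)[OF assms(2), of a] assms that by simp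
qed

lemma collapse_always_in: "collapse always \<in> enriched_functors T"
  using enriched_functor_relation_flow[OF collapse_in(2)] categories_always by (simp add: reflp_def)

end

section \<open>Lifting along the free category functor\<close>

text \<open>The unit, of which \<open>is_left_adjoint\<close> asserts only the existence, becomes a
  parameter. Everything about the free category is drawn from functoriality, naturality and this
  universal property.\<close>

locale free_category_adjunction = convenient_spaces T
  for T :: "'u topology set" +
  fixes Iobj :: "'u flow \<Rightarrow> 'u flow" and Iarr :: "'u flow_map \<Rightarrow> 'u flow_map"
    and unit :: "'u flow \<Rightarrow> 'u flow_map"
  assumes functorial: "is_functor (Flow T) (TopCat T) Iobj Iarr"
    and natural: "is_natural (Flow T) (Flow T) id id (id \<circ> Iobj) (id \<circ> Iarr) unit"
    and universal: "\<And>X Y f. \<lbrakk>X \<in> Obj (Flow T); Y \<in> Obj (TopCat T); f \<in> Hom (Flow T) X (id Y)\<rbrakk> \<Longrightarrow>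
      \<exists>!g. g \<in> Hom (TopCat T) (Iobj X) Y \<and> Comp (Flow T) (id g) (unit X) = f"
begin

lemma Iobj_in: "is_flow T X \<Longrightarrow> is_enriched_category T (Iobj X)"
  using functorial by (simp add: is_functor_def)

lemma Iarr_in:
  assumes "f \<in> flow_maps T"
  shows "Iarr f \<in> enriched_functors T" "Iarr f \<in> flow_maps T"
    "fdom (Iarr f) = Iobj (fdom f)" "fcod (Iarr f) = Iobj (fcod f)"
  using functorial assms by (auto simp: is_functor_def Hom_def enriched_functors_def)

lemma unit_in:
  assumes "is_flow T X"
  shows "unit X \<in> flow_maps T" "fdom (unit X) = X" "fcod (unit X) = Iobj X"
  using natural assms by (auto simp: is_natural_def Hom_def)

lemma unit_states: "\<lbrakk>is_flow T X; a \<in> states X\<rbrakk> \<Longrightarrow> on_states (unit X) a \<in> states (Iobj X)"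
  using flow_mapsD(3)[OF unit_in(1)] unit_in by metis

lemma naturality_states:
  assumes f: "f \<in> flow_maps T" and a: "a \<in> states (fdom f)"
  shows "on_states (Iarr f) (on_states (unit (fdom f)) a) = on_states (unit (fcod f)) (on_states f a)"
proof -
  have "flow_comp (unit (fcod f)) f = flow_comp (Iarr f) (unit (fdom f))"
    using natural f by (simp add: is_natural_def)
  then have "on_states (flow_comp (unit (fcod f)) f) a = on_states (flow_comp (Iarr f) (unit (fdom f))) a"
    by simp
  then show ?thesis
    using a unit_in(2)[OF flow_mapsD(1)[OF f]] by simp
qed

text \<open>The existence half of the adjunction. The triangle is also read on states, where maps
  into relation flows are determined.\<close>

lemma transpose:
  assumes f: "f \<in> flow_maps T" and cod: "is_enriched_category T (fcod f)"
  obtains g where "g \<in> enriched_functors T" "g \<in> flow_maps T" "fdom g = Iobj (fdom f)"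
    "fcod g = fcod f" "flow_comp g (unit (fdom f)) = f"
    "\<And>a. a \<in> states (fdom f) \<Longrightarrow> on_states g (on_states (unit (fdom f)) a) = on_states f a"
proof -
  have X: "is_flow T (fdom f)" using flow_mapsD(1)[OF f] .
  obtain g where g: "g \<in> Hom (TopCat T) (Iobj (fdom f)) (fcod f)"
    "flow_comp g (unit (fdom f)) = f"
    using universal[of "fdom f" "fcod f" f] X f cod by (auto simp: Hom_def)
  then have ends: "g \<in> enriched_functors T" "fdom g = Iobj (fdom f)" "fcod g = fcod f"
    by (simp_all add: Hom_def)
  have "on_states g (on_states (unit (fdom f)) a) = on_states f a" if "a \<in> states (fdom f)" for a
    using arg_cong[OF g(2), of "\<lambda>h. on_states h a"] that unit_in(2)[OF X] by simp
  moreover have "g \<in> flow_maps T" using ends(1) by (simp add: enriched_functors_def)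
  ultimately show ?thesis using that ends g(2) by blast
qed

lemma transpose_unique:
  assumes X: "is_flow T X" and g: "g \<in> enriched_functors T" "h \<in> enriched_functors T"
    and dom: "fdom g = Iobj X" "fdom h = Iobj X" and cod: "fcod g = fcod h"
    and eq: "flow_comp g (unit X) = flow_comp h (unit X)"
  shows "g = h"
proof -
  have Y: "is_enriched_category T (fcod g)" and gm: "g \<in> flow_maps T"
    using g(1) by (auto simp: enriched_functors_def)
  have "flow_comp g (unit X) \<in> flow_maps T"
    using unit_in[OF X] dom gm by (intro flow_comp_in) auto
  then have "flow_comp g (unit X) \<in> Hom (Flow T) X (id (fcod g))"
    using unit_in[OF X] by (simp add: Hom_def)
  from universal[OF _ _ this] X Y have
    "\<exists>!k. k \<in> Hom (TopCat T) (Iobj X) (fcod g) \<and> flow_comp k (unit X) = flow_comp g (unit X)"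
    by simp
  then show ?thesis using g dom cod eq by (auto simp: Hom_def)
qed

text \<open>By transposition, a lift amounts to an extension of a map of states along
  \<open>i\<close>. Any map of states into an indiscrete category is a map of flows, so injectivity
  of \<open>i\<close> suffices.\<close>

lemma lifts_collapse_always:
  assumes i: "i \<in> flow_maps T" and inj: "inj_on (on_states i) (states (fdom i))"
  shows "lifts (TopCat T) (Iarr i) (collapse always)"
  unfolding lifts_def
proof (intro ballI impI)
  let ?A = "fdom i" and ?B = "fcod i"
  let ?Q = "relation_flow always two_states"
  fix u v
  assume "u \<in> Hom (TopCat T) (Dom (TopCat T) (Iarr i)) (Dom (TopCat T) (collapse always))"
    and "v \<in> Hom (TopCat T) (Cod (TopCat T) (Iarr i)) (Cod (TopCat T) (collapse always))"
  then have u: "u \<in> enriched_functors T" "u \<in> flow_maps T" "fdom u = Iobj ?A" "fcod u = ?Q"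
    and v: "v \<in> flow_maps T" "fdom v = Iobj ?B" "fcod v = relation_flow always one_state"
    using Iarr_in[OF i] by (auto simp: Hom_def enriched_functors_def)
  have A: "is_flow T ?A" and B: "is_flow T ?B" using flow_mapsD[OF i] by auto
  \<comment> \<open>Outside the image of \<open>i\<close> any value in \<open>two_states\<close>
    would do; on the image, injectivity makes the preimage unique.\<close>
  define w0 where "w0 b = (if b \<in> on_states i ` states ?A
    then on_states u (on_states (unit ?A) (inv_into (states ?A) (on_states i) b)) else zero_pt)" for b
  have u_two: "on_states u (on_states (unit ?A) a) \<in> two_states" if "a \<in> states ?A" for a
    using flow_mapsD(3)[OF u(2), of "on_states (unit ?A) a"] unit_states[OF A that] u by simp
  have w0_two: "w0 b \<in> two_states" for b
    using u_two inv_into_into[of b "on_states i" "states ?A"] by (auto simp: w0_def)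
  have w0_i: "w0 (on_states i a) = on_states u (on_states (unit ?A) a)" if "a \<in> states ?A" for a
    using that inj by (simp add: w0_def)
  define w where "w = relation_map always two_states ?B w0"
  have w: "w \<in> flow_maps T" "fdom w = ?B" "fcod w = ?Q"
    using relation_map_in[OF B flows_always(1), of w0] w0_two by (auto simp: w_def)
  obtain h where h: "h \<in> enriched_functors T" "h \<in> flow_maps T" "fdom h = Iobj ?B" "fcod h = ?Q"
    and hw: "\<And>b. b \<in> states ?B \<Longrightarrow> on_states h (on_states (unit ?B) b) = on_states w b"
    using transpose[OF w(1)] categories_always(1) w by metis
  have hi: "flow_comp h (Iarr i) \<in> flow_maps T"
    using h Iarr_in[OF i] by (intro flow_comp_in) auto
  \<comment> \<open>Both sides are functors on a free category, so they are compared after the unit,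
    and there on states.\<close>
  have "flow_comp h (Iarr i) = u"
  proof (rule transpose_unique[OF A _ u(1)])
    show "flow_comp h (Iarr i) \<in> enriched_functors T"
      using enriched_functor_relation_flow[OF hi] Iarr_in[OF i] Iobj_in[OF A] h categories_always
      by (simp add: reflp_def)
    show "flow_comp (flow_comp h (Iarr i)) (unit ?A) = flow_comp u (unit ?A)"
    proof (rule relation_map_eqI)
      fix a assume "a \<in> states (fdom (flow_comp (flow_comp h (Iarr i)) (unit ?A)))"
      then have a: "a \<in> states ?A" using unit_in[OF A] by simp
      then show "on_states (flow_comp (flow_comp h (Iarr i)) (unit ?A)) a =
          on_states (flow_comp u (unit ?A)) a"
        using unit_in[OF A] unit_states[OF A] Iarr_in[OF i] naturality_states[OF i a] w0_i[OF a]
          hw[of "on_states i a"] flow_mapsD(3)[OF i a]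
        by (simp add: w_def)
    qed (use unit_in[OF A] hi u h Iarr_in[OF i] in \<open>auto intro!: flow_comp_in\<close>)
  qed (use h u Iarr_in[OF i] in auto)
  moreover have "flow_comp (collapse always) h = v"
    using h v collapse_in by (intro map_to_one_eqI[of _ _ always]) (auto intro!: flow_comp_in)
  ultimately show "\<exists>h\<in>Hom (TopCat T) (Cod (TopCat T) (Iarr i)) (Dom (TopCat T) (collapse always)).
      Comp (TopCat T) h (Iarr i) = u \<and> Comp (TopCat T) (collapse always) h = v"
    using h Iarr_in[OF i] by (intro bexI[of _ h]) (simp_all add: Hom_def)
qed

lemma collapse_always_RLP: "collapse always \<in> RLP (TopCat T) (Iarr ` (Igl \<union> {Cmap}))"
proof -
  have "\<forall>i \<in> Igl \<union> {Cmap}. lifts (TopCat T) (Iarr i) (collapse always)"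
    using lifts_collapse_always generators_in generators_inj by blast
  then show ?thesis using collapse_always_in by (simp add: RLP_def)
qed

text \<open>A lifting problem against sets is enlarged to indiscrete categories, transposed and
  solved there. Restricting the solution along the unit gives a map of states that solves the
  original problem.\<close>

lemma lifts_collapse_never:
  assumes f: "f \<in> flow_maps T" and lift: "lifts (TopCat T) (Iarr f) (collapse always)"
  shows "lifts (Flow T) f (collapse never)"
  unfolding lifts_def
proof (intro ballI impI)
  let ?A = "fdom f" and ?B = "fcod f"
  fix s t
  assume "s \<in> Hom (Flow T) (Dom (Flow T) f) (Dom (Flow T) (collapse never))"
    and "t \<in> Hom (Flow T) (Cod (Flow T) f) (Cod (Flow T) (collapse never))"
  then have s: "s \<in> flow_maps T" "fdom s = ?A" "fcod s = relation_flow never two_states"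
    and t: "t \<in> flow_maps T" "fdom t = ?B" "fcod t = relation_flow never one_state"
    by (auto simp: Hom_def)
  have A: "is_flow T ?A" and B: "is_flow T ?B" using flow_mapsD[OF f] by auto
  \<comment> \<open>\<open>t\<close> ends in a flow without execution paths, so \<open>?B\<close>
    has none either. Hence every map from its states to \<open>two_states\<close> is a map of flows
    into the set.\<close>
  have no_paths: "pspace ?B a b = {}" if "a \<in> states ?B" "b \<in> states ?B" for a b
    using flow_mapsD(5)[OF t(1)] t that by fastforce
  \<comment> \<open>\<open>s\<close> itself has no transpose, as its codomain has no identities;
    \<open>s'\<close> keeps its action on states but ends in a category.\<close>
  define s' where "s' = relation_map always two_states ?A (on_states s)"
  have s': "s' \<in> flow_maps T" "fdom s' = ?A" "fcod s' = relation_flow always two_states"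
    using relation_map_in[OF A flows_always(1), of "on_states s"] flow_mapsD(3)[OF s(1)] s
    by (auto simp: s'_def)
  obtain u where u: "u \<in> enriched_functors T" "u \<in> flow_maps T" "fdom u = Iobj ?A"
      "fcod u = relation_flow always two_states"
    and us: "\<And>a. a \<in> states ?A \<Longrightarrow> on_states u (on_states (unit ?A) a) = on_states s' a"
    using transpose[OF s'(1)] categories_always(1) s' by metis
  define v where "v = relation_map always one_state (Iobj ?B) (\<lambda>b. zero_pt)"
  have vm: "v \<in> flow_maps T" "fdom v = Iobj ?B" "fcod v = relation_flow always one_state"
    using relation_map_in[OF _ flows_always(2)] Iobj_in[OF B]
    by (auto simp: v_def is_enriched_category_def)
  then have v: "v \<in> enriched_functors T"
    using enriched_functor_relation_flow[OF vm(1,3)] Iobj_in[OF B] categories_always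
    by (simp add: reflp_def)
  have "flow_comp (collapse always) u = flow_comp v (Iarr f)"
    using u vm collapse_in Iarr_in[OF f]
    by (intro map_to_one_eqI[of _ _ always]) (auto intro!: flow_comp_in)
  then obtain h where h: "h \<in> enriched_functors T" "fdom h = Iobj ?B"
      "fcod h = relation_flow always two_states" "flow_comp h (Iarr f) = u"
    using lift u v vm Iarr_in[OF f] unfolding lifts_def Hom_def by fastforce
  have hm: "h \<in> flow_maps T" using h(1) by (simp add: enriched_functors_def)
  \<comment> \<open>The lift \<open>h\<close> is read on the states of \<open>?B\<close> through the
    unit.\<close>
  define k0 where "k0 b = on_states h (on_states (unit ?B) b)" for b
  have k0_f: "k0 (on_states f a) = on_states s a" if a: "a \<in> states ?A" for a
  proof -
    have "k0 (on_states f a) = on_states h (on_states (Iarr f) (on_states (unit ?A) a))"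
      using naturality_states[OF f a] by (simp add: k0_def)
    also have "\<dots> = on_states u (on_states (unit ?A) a)"
      using h(4) flow_comp_sel(3)[of "on_states (unit ?A) a" "Iarr f" h] unit_states[OF A a]
        Iarr_in[OF f] by simp
    finally show ?thesis using us[OF a] a by (simp add: s'_def)
  qed
  define k where "k = relation_map never two_states ?B k0"
  have k: "k \<in> flow_maps T" "fdom k = ?B" "fcod k = relation_flow never two_states"
  proof -
    have "k0 b \<in> two_states" if "b \<in> states ?B" for b
      using flow_mapsD(3)[OF hm, of "on_states (unit ?B) b"] unit_states[OF B that] h
      by (simp add: k0_def)
    then show "k \<in> flow_maps T"
      unfolding k_def using no_paths by (intro relation_map_in[OF B flows_never(1)]) auto
  qed (simp_all add: k_def)
  have "flow_comp k f = s"
    using k s f k0_f flow_mapsD(3)[OF f]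
    by (intro relation_map_eqI[of _ _ never two_states]) (auto intro!: flow_comp_in simp: k_def)
  moreover have "flow_comp (collapse never) k = t"
    using k t collapse_in by (intro map_to_one_eqI[of _ _ never]) (auto intro!: flow_comp_in)
  ultimately show "\<exists>h\<in>Hom (Flow T) (Cod (Flow T) f) (Dom (Flow T) (collapse never)).
      Comp (Flow T) h f = s \<and> Comp (Flow T) (collapse never) h = t"
    using k by (intro bexI[of _ k]) (simp_all add: Hom_def)
qed

text \<open>The images \<open>a\<close> and \<open>b\<close> of the two states under the unit have
  no morphism between them in the free category, yet they become one object with an identity. This
  violates the local condition on spaces of morphisms.\<close>

lemma Iarr_collapse_not_DK: "Iarr (collapse never) \<notin> DK_equivalences T"
proof
  let ?E = "relation_flow never two_states" and ?F = "Iarr (collapse never)"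
  assume DK: "?F \<in> DK_equivalences T"
  define a b where "a = on_states (unit ?E) zero_pt" and "b = on_states (unit ?E) one_pt"
  have ab: "a \<in> states (Iobj ?E)" "b \<in> states (Iobj ?E)"
    using unit_states[OF flows_never(1)] by (auto simp: a_def b_def)
  note F = Iarr_in[OF collapse_in(1)]
  have Fab: "on_states ?F b = on_states ?F a"
    using naturality_states[OF collapse_in(1), of zero_pt]
      naturality_states[OF collapse_in(1), of one_pt] by (simp add: a_def b_def)
  \<comment> \<open>The discrete category separates the two states: the transpose \<open>g\<close>
    of the identity on states sends \<open>a\<close> and \<open>b\<close> to distinct objects, so a
    morphism from \<open>a\<close> to \<open>b\<close> would have an image in an empty
    space.\<close>
  have disc: "is_enriched_category T (relation_flow (=) two_states)"
    by (rule is_enriched_category_relation_flow) (auto simp: transp_on_def reflp_def)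
  let ?d = "relation_map (=) two_states ?E id"
  have d: "?d \<in> flow_maps T"
    using disc by (intro relation_map_in[OF flows_never(1)]) (auto simp: is_enriched_category_def)
  obtain g where g: "g \<in> flow_maps T" "fdom g = Iobj (fdom ?d)" "fcod g = fcod ?d"
    and gd: "\<And>c. c \<in> states (fdom ?d) \<Longrightarrow> on_states g (on_states (unit (fdom ?d)) c) = on_states ?d c"
    by (rule transpose[OF d]) (use disc in simp_all)
  have "on_states g a = zero_pt" "on_states g b = one_pt"
    using gd[of zero_pt] gd[of one_pt] by (simp_all add: a_def b_def)
  note g = g this
  have "pspace (Iobj ?E) a b = {}"
    using flow_mapsD(5)[OF g(1), of a b] g ab zero_neq_one[OF inaccessible] by fastforce
  then have "path_components_of (paths (Iobj ?E) a b) = {}"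
    by (simp add: path_components_of_def)
  moreover have "weak_homotopy_equivalence (paths (Iobj ?E) a b)
      (paths (fcod ?F) (on_states ?F a) (on_states ?F a)) (on_paths ?F a b)"
  proof -
    have "\<forall>a \<in> states (fdom ?F). \<forall>b \<in> states (fdom ?F). weak_homotopy_equivalence
        (paths (fdom ?F) a b) (paths (fcod ?F) (on_states ?F a) (on_states ?F b)) (on_paths ?F a b)"
      using DK by (simp add: DK_equivalences_def)
    then have "weak_homotopy_equivalence (paths (fdom ?F) a b)
        (paths (fcod ?F) (on_states ?F a) (on_states ?F b)) (on_paths ?F a b)"
      using ab F(3) by simp
    then show ?thesis by (simp add: Fab F(3))
  qed
  \<comment> \<open>A bijection on path components with empty source forces an empty target.\<close>
  ultimately have "path_components_of (paths (fcod ?F) (on_states ?F a) (on_states ?F a)) = {}"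
    by (auto simp: weak_homotopy_equivalence_def bij_betw_def)
  then have "pspace (fcod ?F) (on_states ?F a) (on_states ?F a) = {}"
    by (simp add: path_components_of_def)
  moreover have "is_enriched_category T (fcod ?F)" "on_states ?F a \<in> states (fcod ?F)"
    using F flow_mapsD(3)[OF F(2)] ab by (auto simp: enriched_functors_def)
  ultimately show False
    using is_identity_identity[of T "fcod ?F" "on_states ?F a"] by (simp add: is_identity_def)
qed

end

theorem theorem3p5:
  fixes T :: "'u topology set"
    and Iobj :: "'u flow \<Rightarrow> 'u flow"
    and Iarr :: "'u flow_map \<Rightarrow> 'u flow_map"
  assumes "inaccessible TYPE('u)"
    and "convenient T"
    and "locally_presentable TYPE('u) (spaces T)"
    and "is_left_adjoint (Flow T) (TopCat T) Iobj Iarr id id"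
  shows "\<not> (\<exists>Cof Fib Weq. model_structure (Flow T) Cof Fib Weq \<and>
              Cof = preimage_class (Flow T) Iarr (Ilias_cofibrations T Iarr) \<and>
              Weq = preimage_class (Flow T) Iarr (Ilias_weak_equivalences T))"
proof
  assume "\<exists>Cof Fib Weq. model_structure (Flow T) Cof Fib Weq \<and>
              Cof = preimage_class (Flow T) Iarr (Ilias_cofibrations T Iarr) \<and>
              Weq = preimage_class (Flow T) Iarr (Ilias_weak_equivalences T)"
  then obtain Fib where model: "model_structure (Flow T)
      (preimage_class (Flow T) Iarr (Ilias_cofibrations T Iarr)) Fib
      (preimage_class (Flow T) Iarr (Ilias_weak_equivalences T))"
    by blast
  obtain unit where "free_category_adjunction T Iobj Iarr unit"
    using assms unfolding is_left_adjoint_def free_category_adjunction_def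
      convenient_spaces_def free_category_adjunction_axioms_def by blast
  then interpret free_category_adjunction T Iobj Iarr unit .
  \<comment> \<open>The image of \<open>f\<close> lies in the \<open>LLP\<close> of a class that
    contains \<open>collapse always\<close>.\<close>
  have "lifts (Flow T) f (collapse never)"
    if "f \<in> preimage_class (Flow T) Iarr (Ilias_cofibrations T Iarr)" for f
    using that collapse_always_RLP
    by (intro lifts_collapse_never) (auto simp: preimage_class_def Ilias_cofibrations_def LLP_def)
  then have "collapse never \<in> preimage_class (Flow T) Iarr (Ilias_weak_equivalences T)"
    using RLP_Cof_imp_Weq[OF is_category_Flow model] collapse_in(1) by simp
  then show False
    using Iarr_collapse_not_DK by (simp add: preimage_class_def Ilias_weak_equivalences_def)
qed

end
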